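(* Let $S$ be an Arf numerical semigroup with multiplicity $4$ and conductor $s>4$. (1) If $s\equiv 2\bmod 4$, then $S=\langle 4,4k+2,s+1,s+3\rangle$ for some $k\in\{1,\dots,\frac{s-2}{4}\}$, $\mathrm{PF}(S)=\{4k-2,s-3,s-1\}$, and: (i) the unique row-factorization matrix of $4k-2$ is \[\begin{bmatrix}-1&1&0&0\\ 2k&-1&0&0\\ k-1&0&-1&1\\ k&0&1&-1\end{bmatrix};\] (ii) the row-factorization matrices of $s-3$ are exactly \[\begin{bmatrix}-1&0&1&0\\ k-1&-1&0&1\\ \frac{s}{2}-a-(2a-1)k&2a-1&-1&0\\ \frac{s}{2}-b-2bk&2b&0&-1\end{bmatrix}\] with $a,b\in\mathbb{N}_0$, $1\le a\le\frac{s+2k}{2(2k+1)}$, $0\le b\le\frac{s}{2(2k+1)}$; (iii) the row-factorization matrices of $s-1$ are exactly \[\begin{bmatrix}-1&0&0&1\\ k&-1&1&0\\ \frac{s}{2}-b-2bk&2b&-1&0\\ \frac{s}{2}-a+1-(2a-1)k&2a-1&0&-1\end{bmatrix}\text{ or }\begin{bmatrix}-1&0&0&1\\ k&-1&1&0\\ \frac{s}{2}-b-2bk&2b&-1&0\\ 0&0&2&-1\end{bmatrix}\] with $a,b\in\mathbb{N}_0$, $1\le a\le\frac{s+2k+2}{2(2k+1)}$, $0\le b\le\frac{s}{2(2k+1)}$. (2) If $s\equiv 3\bmod 4$, then $S=\langle 4,s,s+2,s+3\rangle$, $\mathrm{PF}(S)=\{s-4,s-2,s-1\}$, and: (i) the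 unique row-factorization matrix of $s-4$ is \[\begin{bmatrix}-1&1&0&0\\ \frac{s-7}{4}&-1&0&1\\ \frac{s-1}{2}&0&-1&0\\ \frac{s-3}{4}&0&1&-1\end{bmatrix};\] (ii) the row-factorization matrices of $s-2$ are exactly \[\begin{bmatrix}-1&0&1&0\\ \frac{s-1}{2}&-1&0&0\\ \frac{s-3}{4}&0&-1&1\\ \frac{s+1}{4}&1&0&-1\end{bmatrix}\text{ and }\begin{bmatrix}-1&0&1&0\\ \frac{s-1}{2}&-1&0&0\\ 0&2&-1&0\\ \frac{s+1}{4}&1&0&-1\end{bmatrix};\] (iii) the row-factorization matrices of $s-1$ are exactly \[\begin{bmatrix}-1&0&0&1\\ \frac{s-3}{4}&-1&1&0\\ \frac{s+1}{4}&1&-1&0\\ 0&1&1&-1\end{bmatrix}\text{ and }\begin{bmatrix}-1&0&0&1\\ \frac{s-3}{4}&-1&1&0\\ \frac{s+1}{4}&1&-1&0\\ \frac{s+1}{2}&0&0&-1\end{bmatrix}.\]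
   Context: A numerical semigroup is a subset $S\subseteq\mathbb{N}_0$ (non-negative integers) containing $0$, closed under addition, with finite complement in $\mathbb{N}_0$; $\langle A\rangle$ is the set of $\mathbb{N}_0$-linear combinations of elements of $A$. The multiplicity is the smallest nonzero element of $S$; the conductor is one plus the greatest integer not in $S$. $S$ is Arf if $s_2+s_3-s_1\in S$ for all $s_1\le s_2\le s_3$ in $S$. $\mathrm{PF}(S)$ is the set of integers $z\notin S$ with $z+x\in S$ for all nonzero $x\in S$. If $n_1<\dots<n_e$ are the minimal generators of $S$, a row-factorization matrix of $f\in\mathrm{PF}(S)$ is an $e\times e$ integer matrix $[a_{ij}]$ with $a_{ii}=-1$, $a_{ij}\in\mathbb{N}_0$ for $i\ne j$, and $f=\sum_{j=1}^e a_{ij}n_j$ for each $i$. *)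

theory Defs
  imports Complex_Main "Jordan_Normal_Form.Matrix"
begin

definition numerical_semigroup :: "nat set \<Rightarrow> bool" where
  "numerical_semigroup S \<longleftrightarrow>
     0 \<in> S \<and> (\<forall>x\<in>S. \<forall>y\<in>S. x + y \<in> S) \<and> finite (- S)"

definition generated :: "nat set \<Rightarrow> nat set" where
  "generated A = {(\<Sum>x\<in>F. c x * x) | F c. finite F \<and> F \<subseteq> A}"

definition semigroup_multiplicity :: "nat set \<Rightarrow> nat" where
  "semigroup_multiplicity S = (LEAST x. x \<in> S \<and> x \<noteq> 0)"

(* The greatest integer outside S is at least -1 (with equality iff S is all of
   the naturals), so the coercion to nat loses nothing. *)
definition conductor :: "nat set \<Rightarrow> nat" where
  "conductor S = nat (1 + (GREATEST z :: int. z \<notin> int ` S))"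

(* The subtraction does not truncate, since s1 \<le> s2. *)
definition arf :: "nat set \<Rightarrow> bool" where
  "arf S \<longleftrightarrow>
     (\<forall>s1\<in>S. \<forall>s2\<in>S. \<forall>s3\<in>S. s1 \<le> s2 \<and> s2 \<le> s3 \<longrightarrow> s2 + s3 - s1 \<in> S)"

definition PF :: "nat set \<Rightarrow> int set" where
  "PF S = {z. z \<notin> int ` S \<and> (\<forall>x\<in>S. x \<noteq> 0 \<longrightarrow> z + int x \<in> int ` S)}"

definition minimal_generating_set :: "nat set \<Rightarrow> nat set \<Rightarrow> bool" where
  "minimal_generating_set S A \<longleftrightarrow>
     generated A = S \<and> (\<forall>B. B \<subset> A \<longrightarrow> generated B \<noteq> S)"

(* The list ns enumerates the minimal generators increasingly; it is determined
   by S, because a numerical semigroup has exactly one minimal generating set.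
   Rows and columns are indexed from 0. *)
definition row_factorization_matrix :: "nat set \<Rightarrow> int \<Rightarrow> int mat \<Rightarrow> bool" where
  "row_factorization_matrix S f M \<longleftrightarrow>
     f \<in> PF S \<and>
     (\<exists>ns. sorted_wrt (<) ns \<and> minimal_generating_set S (set ns) \<and>
        M \<in> carrier_mat (length ns) (length ns) \<and>
        (\<forall>i < length ns. M $$ (i, i) = -1) \<and>
        (\<forall>i < length ns. \<forall>j < length ns. i \<noteq> j \<longrightarrow> M $$ (i, j) \<ge> 0) \<and>
        (\<forall>i < length ns. f = (\<Sum>j < length ns. M $$ (i, j) * int (ns ! j))))"

end

theory Submission
  imports Defs
begin

text \<open>
  In an Arf semigroup two consecutive elements \<open>x, x + 1\<close> force
  everything above \<open>x\<close> into the semigroup. If all multiples of four are present, every odd element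
  has such a neighbour, so odd elements start only at the conductor \<open>s\<close>. The class of \<open>2\<close> modulo
  four is therefore the only one with any freedom. If \<open>s = 4 m + 2\<close>, it starts at some \<open>4 k + 2 \<le> s\<close>;
  if \<open>s = 4 m + 3\<close>, the last gap \<open>s - 1\<close> lies in it and it starts at \<open>s + 3\<close>.

  Recording where the nonzero classes modulo four start (the Kunz coordinates) treats both cases
  together. The sum of two nonzero elements always lies strictly above the least nonzero element of
  its class (\<open>add_nonzero_mem\<close>). Consequently the four class minima, with four itself for the class of
  zero, are the minimal generators, and subtracting four from the other three gives the
  pseudo-Frobenius numbers.

  Row \<open>i\<close> of a row-factorization matrix of \<open>f\<close> is a factorization of \<open>f + n\<^sub>i\<close> over the three other
  generators, and the rows do not interact, so the set of matrices is a product of four sets of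
  factorizations. These are computed by size and parity: the large generators can occur at most
  twice, and residues decide which occurrences are possible. The only families of
  solutions that grow with \<open>s\<close> come from \<open>4\<close> and \<open>4 k + 2\<close>, where after halving one solves \<open>2 p + (2 k + 1) q = u\<close>;
  the parity of \<open>q\<close> is that of \<open>u\<close>, which yields the parameters \<open>q = 2 a - 1\<close> and \<open>q = 2 b\<close>.
\<close>

section \<open>Generated monoids and minimal generators\<close>

lemma sum_in_generated: "finite F \<Longrightarrow> F \<subseteq> A \<Longrightarrow> (\<Sum>x\<in>F. c x * x) \<in> generated A"
  unfolding generated_def by auto

lemma subset_generated: "A \<subseteq> generated A"
  unfolding generated_def by (auto intro!: exI[of _ "{x}" for x] exI[of _ "\<lambda>_. 1"])

lemma zero_in_generated: "0 \<in> generated A"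
  unfolding generated_def by (auto intro!: exI[of _ "{}"])

lemma add_in_generated:
  assumes "x \<in> generated A" "y \<in> generated A"
  shows "x + y \<in> generated A"
proof -
  obtain F c where F: "x = (\<Sum>z\<in>F. c z * z)" "finite F" "F \<subseteq> A"
    using assms(1) unfolding generated_def by blast
  obtain G d where G: "y = (\<Sum>z\<in>G. d z * z)" "finite G" "G \<subseteq> A"
    using assms(2) unfolding generated_def by blast
  define c' where "c' z = (if z \<in> F then c z else 0)" for z
  define d' where "d' z = (if z \<in> G then d z else 0)" for z
  have "x = (\<Sum>z\<in>F \<union> G. c' z * z)"
    unfolding F(1) using F(2) G(2) by (intro sum.mono_neutral_cong_left) (auto simp: c'_def)
  moreover have "y = (\<Sum>z\<in>F \<union> G. d' z * z)"
    unfolding G(1) using F(2) G(2) by (intro sum.mono_neutral_cong_left) (auto simp: d'_def)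
  ultimately have "x + y = (\<Sum>z\<in>F \<union> G. (c' z + d' z) * z)"
    by (simp add: sum.distrib add_mult_distrib)
  also have "\<dots> \<in> generated A"
    using F(2,3) G(2,3) by (intro sum_in_generated) auto
  finally show ?thesis .
qed

lemma mult_in_generated: "x \<in> generated A \<Longrightarrow> n * x \<in> generated A"
  by (induction n) (auto intro: zero_in_generated add_in_generated)

lemma generated_least:
  assumes "A \<subseteq> S" "0 \<in> S" and add: "\<And>x y. x \<in> S \<Longrightarrow> y \<in> S \<Longrightarrow> x + y \<in> S"
  shows "generated A \<subseteq> S"
proof
  fix x assume "x \<in> generated A"
  then obtain F c where F: "x = (\<Sum>z\<in>F. c z * z)" "finite F" "F \<subseteq> A"
    unfolding generated_def by blast
  have mult: "n * z \<in> S" if "z \<in> S" for n z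
    using that assms by (induction n) auto
  from F(2,3) have "(\<Sum>z\<in>F. c z * z) \<in> S"
    using assms(1,2) by (induction F) (auto intro!: add mult)
  with F show "x \<in> S" by simp
qed

text \<open>An element with no proper decomposition cannot be produced from other generators: split one
  generator off any representation of it, and what is left over must vanish.\<close>

lemma atom_mem_generating_set:
  assumes "x \<in> generated A" "x \<noteq> 0"
    and atom: "\<And>y z. y \<in> generated A \<Longrightarrow> z \<in> generated A \<Longrightarrow> x = y + z \<Longrightarrow> y = 0 \<or> z = 0"
  shows "x \<in> A"
proof -
  obtain F c where F: "x = (\<Sum>z\<in>F. c z * z)" "finite F" "F \<subseteq> A"
    using assms(1) unfolding generated_def by blast
  have "\<exists>y\<in>F. c y * y \<noteq> 0"
    using F(1) assms(2) by (metis (no_types, lifting) sum.neutral)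
  then obtain y where y: "y \<in> F" "c y * y \<noteq> 0" by blast
  define r where "r = (c y - 1) * y + (\<Sum>z\<in>F - {y}. c z * z)"
  have "c y * y = y + (c y - 1) * y"
    using y(2) by (cases "c y") auto
  then have x: "x = y + r"
    unfolding F(1) r_def using F(2) y(1) by (simp add: sum.remove)
  have yA: "y \<in> generated A"
    using y(1) F(3) subset_generated[of A] by auto
  have "(\<Sum>z\<in>F - {y}. c z * z) \<in> generated A"
    using F by (intro sum_in_generated) auto
  then have "r \<in> generated A"
    unfolding r_def by (intro add_in_generated mult_in_generated yA)
  with atom[OF yA _ x] y(2) have "r = 0" by auto
  with x y(1) F(3) show ?thesis by auto
qed

text \<open>Irreducible generators lie in every generating set, so a generating set consisting of them is
  the only minimal one.\<close>

lemma minimal_generating_set_iff_atoms: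
  assumes S: "generated G = S"
    and atom: "\<And>g y z. g \<in> G \<Longrightarrow> y \<in> S \<Longrightarrow> z \<in> S \<Longrightarrow> g = y + z \<Longrightarrow> y = 0 \<or> z = 0"
    and "0 \<notin> G"
  shows "minimal_generating_set S A \<longleftrightarrow> A = G"
proof -
  have sub: "G \<subseteq> B" if B: "generated B = S" for B
  proof
    fix g assume g: "g \<in> G"
    then have "g \<in> generated B" unfolding B S[symmetric] by (rule subsetD[OF subset_generated])
    moreover have "g \<noteq> 0" using g assms(3) by (cases "g = 0") auto
    ultimately show "g \<in> B"
      by (rule atom_mem_generating_set) (unfold B, rule atom[OF g])
  qed
  have proper: "generated B \<noteq> S" if "B \<subset> G" for B
  proof
    assume "generated B = S"
    from sub[OF this] that show False by (simp add: psubset_eq order.antisym)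
  qed
  show ?thesis
  proof
    assume A: "minimal_generating_set S A"
    then have gen: "generated A = S" and min: "\<And>B. B \<subset> A \<Longrightarrow> generated B \<noteq> S"
      by (simp_all add: minimal_generating_set_def)
    from sub[OF gen] min[of G] S show "A = G" by (metis psubsetI)
  qed (simp add: minimal_generating_set_def S proper)
qed

section \<open>Conductor and multiplicity\<close>

lemma int_mem_image_iff: "z \<in> int ` S \<longleftrightarrow> 0 \<le> z \<and> nat z \<in> S"
  by (auto simp: image_iff intro!: bexI[of _ "nat z"])

lemma conductor_spec:
  assumes "numerical_semigroup S" "conductor S > 0"
  shows "conductor S - 1 \<notin> S" and "\<And>x. x \<ge> conductor S \<Longrightarrow> x \<in> S"
proof -
  have fin: "finite (- S)" using assms(1) by (simp add: numerical_semigroup_def)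
  have "- S \<noteq> {}"
  proof
    assume "- S = {}"
    then have "S = UNIV" by blast
    then have "(GREATEST z :: int. z \<notin> int ` S) = -1"
      by (intro Greatest_equality) (auto simp: int_mem_image_iff)
    with assms(2) show False by (simp add: conductor_def)
  qed
  then have M: "Max (- S) \<notin> S" "\<And>x. x \<notin> S \<Longrightarrow> x \<le> Max (- S)"
    using Max_in[OF fin] fin by auto
  have "(GREATEST z :: int. z \<notin> int ` S) = int (Max (- S))"
  proof (rule Greatest_equality)
    show "int (Max (- S)) \<notin> int ` S" using M(1) by auto
    fix z :: int assume z: "z \<notin> int ` S"
    show "z \<le> int (Max (- S))"
    proof (cases "z < 0")
      case False
      then have "z = int (nat z)" by simp
      with z M(2)[of "nat z"] show ?thesis by (metis imageI of_nat_mono)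
    qed simp
  qed
  then have c: "conductor S = Suc (Max (- S))" by (simp add: conductor_def)
  show "conductor S - 1 \<notin> S" using M(1) c by simp
  show "x \<in> S" if "x \<ge> conductor S" for x using M(2)[of x] that c by force
qed

lemma semigroup_multiplicity_spec:
  assumes "x \<in> S" "x \<noteq> 0"
  shows "semigroup_multiplicity S \<in> S"
    and "\<And>y. y \<in> S \<Longrightarrow> y \<noteq> 0 \<Longrightarrow> semigroup_multiplicity S \<le> y"
  using LeastI[of "\<lambda>x. x \<in> S \<and> x \<noteq> 0" x] Least_le[of "\<lambda>x. x \<in> S \<and> x \<noteq> 0"] assms
  unfolding semigroup_multiplicity_def by auto

text \<open>From two consecutive elements \<open>x, x + 1\<close> the Arf condition produces
  \<open>2 (x + 1) - x = x + 2\<close>, and so on without end; hence no gap lies above them.\<close>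

lemma arf_consecutive_ge_conductor:
  assumes "numerical_semigroup S" "arf S" "conductor S > 0" "x \<in> S" "Suc x \<in> S"
  shows "x \<ge> conductor S"
proof -
  have "x + n \<in> S \<and> Suc (x + n) \<in> S" for n
  proof (induction n)
    case (Suc n)
    then have "Suc (x + n) + Suc (x + n) - (x + n) \<in> S"
      using assms(2) unfolding arf_def by (meson le_refl lessI less_imp_le)
    then show ?case using Suc by simp
  qed (use assms in auto)
  then have "y \<in> S" if "y \<ge> x" for y
    using that le_Suc_ex by blast
  with conductor_spec(1)[OF assms(1,3)] have "conductor S - 1 < x"
    by (meson not_le)
  then show ?thesis by simp
qed

section \<open>Arf semigroups of multiplicity four\<close>

text \<open>A multiple of four lies next to every odd number, so an odd element below the conductor
  would give two consecutive elements there.\<close>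

lemma arf_odd_ge_conductor:
  assumes "numerical_semigroup S" "arf S" "conductor S > 0"
    and four: "\<And>n. 4 * n \<in> S" and "x \<in> S" "odd x"
  shows "x \<ge> conductor S"
proof -
  consider n where "x = Suc (4 * n)" | n where "Suc x = 4 * n"
  proof -
    have "(\<exists>n. x = Suc (4 * n)) \<or> (\<exists>n. Suc x = 4 * n)"
      using \<open>odd x\<close> by presburger
    then show thesis using that by blast
  qed
  then show ?thesis
  proof cases
    case (1 n)
    with arf_consecutive_ge_conductor[OF assms(1-3), of "4 * n"] four assms(5)
    show ?thesis by auto
  next
    case (2 n)
    with arf_consecutive_ge_conductor[OF assms(1-3), of x] four assms(5)
    show ?thesis by metis
  qed
qed

text \<open>These are the Kunz coordinates with respect to four: \<open>4 k\<^sub>i + i\<close> is the least element of \<open>S\<close>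
  congruent to \<open>i\<close>, so the tuple lists the nonzero part of the Apery set.\<close>

definition kunz_coordinates :: "nat set \<Rightarrow> nat \<Rightarrow> nat \<Rightarrow> nat \<Rightarrow> bool" where
  "kunz_coordinates S k1 k2 k3 \<longleftrightarrow>
     (\<forall>q. 4 * q \<in> S \<and> (4 * q + 1 \<in> S \<longleftrightarrow> k1 \<le> q) \<and> (4 * q + 2 \<in> S \<longleftrightarrow> k2 \<le> q) \<and> (4 * q + 3 \<in> S \<longleftrightarrow> k3 \<le> q))"

text \<open>The odd classes have no element below the conductor, whereas the class of two may start anywhere up
  to it except at \<open>2\<close>, which the multiplicity excludes.\<close>

lemma arf_multiplicity_four_kunz_2_mod_4:
  assumes S: "numerical_semigroup S" "arf S" "semigroup_multiplicity S = 4"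
    and c: "conductor S = 4 * m + 2"
  shows "\<exists>k\<in>{1..m}. kunz_coordinates S (m + 1) k m"
proof -
  have pos: "conductor S > 0" using c by simp
  have big: "x \<in> S" if "x \<ge> 4 * m + 2" for x
    using conductor_spec(2)[OF S(1) pos] that c by simp
  have add: "x \<in> S \<Longrightarrow> y \<in> S \<Longrightarrow> x + y \<in> S" for x y
    using S(1) by (simp add: numerical_semigroup_def)
  have mul: "4 \<in> S" "\<And>y. y \<in> S \<Longrightarrow> y \<noteq> 0 \<Longrightarrow> 4 \<le> y"
    using semigroup_multiplicity_spec[OF big[OF order_refl]] S(3) by auto
  have four: "4 * n \<in> S" for n
    using S(1) by (induction n) (auto simp: numerical_semigroup_def intro: add mul)
  have odd: "x \<ge> 4 * m + 2" if "x \<in> S" "odd x" for x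
    using arf_odd_ge_conductor[OF S(1,2) pos four that] c by simp
  have one: "4 * q + 1 \<in> S \<longleftrightarrow> m + 1 \<le> q" and three: "4 * q + 3 \<in> S \<longleftrightarrow> m \<le> q" for q
    using odd[of "4 * q + 1"] big[of "4 * q + 1"] odd[of "4 * q + 3"] big[of "4 * q + 3"] by auto
  define k where "k = (LEAST k. 4 * k + 2 \<in> S)"
  have k: "4 * k + 2 \<in> S" "\<And>j. 4 * j + 2 \<in> S \<Longrightarrow> k \<le> j"
    using LeastI[of "\<lambda>k. 4 * k + 2 \<in> S" m] Least_le[of "\<lambda>k. 4 * k + 2 \<in> S"] big
    unfolding k_def by auto
  have "4 * q + 2 \<in> S \<longleftrightarrow> k \<le> q" for q
  proof
    assume "k \<le> q"
    then have "4 * q + 2 = 4 * (q - k) + (4 * k + 2)" by simp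
    then show "4 * q + 2 \<in> S" using add[OF four k(1)] by metis
  qed (rule k(2))
  moreover have "1 \<le> k" using mul(2)[OF k(1)] by simp
  moreover have "k \<le> m" using k(2) big by simp
  ultimately show ?thesis
    unfolding kunz_coordinates_def using four one three by (intro bexI[of _ k]) auto
qed

text \<open>Here the last gap is congruent to two modulo four, so adding multiples of four to any
  smaller element of that class would fill it.\<close>

lemma arf_multiplicity_four_kunz_3_mod_4:
  assumes S: "numerical_semigroup S" "arf S" "semigroup_multiplicity S = 4"
    and c: "conductor S = 4 * m + 3"
  shows "kunz_coordinates S (m + 1) (m + 1) m"
proof -
  have pos: "conductor S > 0" using c by simp
  have big: "x \<in> S" if "x \<ge> 4 * m + 3" for x
    using conductor_spec(2)[OF S(1) pos] that c by simp
  have gap: "4 * m + 2 \<notin> S"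
    using conductor_spec(1)[OF S(1) pos] c by simp
  have add: "x \<in> S \<Longrightarrow> y \<in> S \<Longrightarrow> x + y \<in> S" for x y
    using S(1) by (simp add: numerical_semigroup_def)
  have "4 \<in> S"
    using semigroup_multiplicity_spec(1)[OF big[OF order_refl]] S(3) by auto
  then have four: "4 * n \<in> S" for n
    using S(1) by (induction n) (auto simp: numerical_semigroup_def intro: add)
  have odd: "x \<ge> 4 * m + 3" if "x \<in> S" "odd x" for x
    using arf_odd_ge_conductor[OF S(1,2) pos four that] c by simp
  have "4 * q + 1 \<in> S \<longleftrightarrow> m + 1 \<le> q" "4 * q + 3 \<in> S \<longleftrightarrow> m \<le> q" for q
    using odd[of "4 * q + 1"] big[of "4 * q + 1"] odd[of "4 * q + 3"] big[of "4 * q + 3"] by auto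
  moreover have "4 * q + 2 \<in> S \<longleftrightarrow> m + 1 \<le> q" for q
  proof
    assume q: "4 * q + 2 \<in> S"
    show "m + 1 \<le> q"
    proof (rule ccontr)
      assume "\<not> m + 1 \<le> q"
      then have "4 * m + 2 = 4 * (m - q) + (4 * q + 2)" by simp
      with add[OF four q] gap show False by metis
    qed
  qed (use big in auto)
  ultimately show ?thesis unfolding kunz_coordinates_def using four by blast
qed

section \<open>Pseudo-Frobenius numbers and minimal generators\<close>

text \<open>Write \<open>w\<^sub>i = 4 k\<^sub>i + i\<close>. The four inequalities say that \<open>w\<^sub>1 + w\<^sub>1\<close>, \<open>w\<^sub>1 + w\<^sub>2\<close>, \<open>w\<^sub>2 + w\<^sub>3\<close> and
  \<open>w\<^sub>3 + w\<^sub>3\<close> are larger than the class minimum that they are congruent to. The two remaining sums are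
  multiples of four, and positivity of the coordinates makes them larger than four. Thus \<open>S\<close> has as
  many minimal generators as its multiplicity permits.\<close>

locale kunz_four =
  fixes S :: "nat set" and k1 k2 k3 :: nat
  assumes coords: "kunz_coordinates S k1 k2 k3"
    and pos: "1 \<le> k1" "1 \<le> k2" "1 \<le> k3"
    and irred: "k2 < 2 * k1" "k3 < k1 + k2" "k1 < k2 + k3 + 1" "k2 < 2 * k3 + 1"
begin

lemma mem_classes:
  "4 * q \<in> S" "4 * q + 1 \<in> S \<longleftrightarrow> k1 \<le> q" "4 * q + 2 \<in> S \<longleftrightarrow> k2 \<le> q" "4 * q + 3 \<in> S \<longleftrightarrow> k3 \<le> q"
  using coords by (auto simp: kunz_coordinates_def)

lemma mem_iff:
  "x \<in> S \<longleftrightarrow> (\<exists>q. x = 4 * q \<or> x = 4 * q + 1 \<and> k1 \<le> q \<or> x = 4 * q + 2 \<and> k2 \<le> q \<or> x = 4 * q + 3 \<and> k3 \<le> q)"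
proof -
  have "\<exists>q. x = 4 * q \<or> x = 4 * q + 1 \<or> x = 4 * q + 2 \<or> x = 4 * q + 3" by presburger
  then show ?thesis using mem_classes by blast
qed

lemma int_mem_classes:
  fixes q :: int
  shows "4 * q \<in> int ` S \<longleftrightarrow> 0 \<le> q" "4 * q + 1 \<in> int ` S \<longleftrightarrow> int k1 \<le> q"
    "4 * q + 2 \<in> int ` S \<longleftrightarrow> int k2 \<le> q" "4 * q + 3 \<in> int ` S \<longleftrightarrow> int k3 \<le> q"
proof -
  consider n where "q = int n" | "q < 0" by (metis nonneg_int_cases not_le)
  then have "(4 * q \<in> int ` S \<longleftrightarrow> 0 \<le> q) \<and> (4 * q + 1 \<in> int ` S \<longleftrightarrow> int k1 \<le> q) \<and>
    (4 * q + 2 \<in> int ` S \<longleftrightarrow> int k2 \<le> q) \<and> (4 * q + 3 \<in> int ` S \<longleftrightarrow> int k3 \<le> q)"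
  proof cases
    case (1 n)
    have "4 * q = int (4 * n)" "4 * q + 1 = int (4 * n + 1)" "4 * q + 2 = int (4 * n + 2)"
      "4 * q + 3 = int (4 * n + 3)" using 1 by auto
    then show ?thesis using mem_classes[of n] 1 by (auto simp only: int_mem_image_iff nat_int of_nat_0_le_iff of_nat_le_iff)
  qed (auto simp: int_mem_image_iff)
  then show "4 * q \<in> int ` S \<longleftrightarrow> 0 \<le> q" "4 * q + 1 \<in> int ` S \<longleftrightarrow> int k1 \<le> q"
    "4 * q + 2 \<in> int ` S \<longleftrightarrow> int k2 \<le> q" "4 * q + 3 \<in> int ` S \<longleftrightarrow> int k3 \<le> q" by auto
qed

lemma nonzero_mem_cases:
  assumes "x \<in> S" "x \<noteq> 0"
  obtains q where "x = 4 * q" "1 \<le> q" | q where "x = 4 * q + 1" "k1 \<le> q"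
    | q where "x = 4 * q + 2" "k2 \<le> q" | q where "x = 4 * q + 3" "k3 \<le> q"
proof -
  obtain q where "x = 4 * q \<or> x = 4 * q + 1 \<and> k1 \<le> q \<or> x = 4 * q + 2 \<and> k2 \<le> q \<or> x = 4 * q + 3 \<and> k3 \<le> q"
    using assms(1) unfolding mem_iff by blast
  moreover have "1 \<le> q" if "x = 4 * q" using that assms(2) by simp
  ultimately show thesis using that by blast
qed

text \<open>This is where the inequalities on the coordinates enter. A carry adds one to \<open>p + q\<close> when the two
  residues sum to four or more.\<close>

lemma add_nonzero_mem:
  assumes "x \<in> S" "x \<noteq> 0" "y \<in> S" "y \<noteq> 0"
  shows "\<exists>q. x + y = 4 * q \<and> 1 < q \<or> x + y = 4 * q + 1 \<and> k1 < q
    \<or> x + y = 4 * q + 2 \<and> k2 < q \<or> x + y = 4 * q + 3 \<and> k3 < q"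
  using assms(1,2)
proof (cases rule: nonzero_mem_cases)
  case x: (1 p)
  from assms(3,4) show ?thesis
  proof (cases rule: nonzero_mem_cases)
    case (1 q)
    then show ?thesis using x pos irred by (intro exI[of _ "p + q"]) auto
  next
    case (2 q)
    then show ?thesis using x pos irred by (intro exI[of _ "p + q"]) auto
  next
    case (3 q)
    then show ?thesis using x pos irred by (intro exI[of _ "p + q"]) auto
  next
    case (4 q)
    then show ?thesis using x pos irred by (intro exI[of _ "p + q"]) auto
  qed
next
  case x: (2 p)
  from assms(3,4) show ?thesis
  proof (cases rule: nonzero_mem_cases)
    case (1 q)
    then show ?thesis using x pos irred by (intro exI[of _ "p + q"]) auto
  next
    case (2 q)
    then show ?thesis using x pos irred by (intro exI[of _ "p + q"]) auto
  next
    case (3 q)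
    then show ?thesis using x pos irred by (intro exI[of _ "p + q"]) auto
  next
    case (4 q)
    then show ?thesis using x pos irred by (intro exI[of _ "p + q + 1"]) auto
  qed
next
  case x: (3 p)
  from assms(3,4) show ?thesis
  proof (cases rule: nonzero_mem_cases)
    case (1 q)
    then show ?thesis using x pos irred by (intro exI[of _ "p + q"]) auto
  next
    case (2 q)
    then show ?thesis using x pos irred by (intro exI[of _ "p + q"]) auto
  next
    case (3 q)
    then show ?thesis using x pos irred by (intro exI[of _ "p + q + 1"]) auto
  next
    case (4 q)
    then show ?thesis using x pos irred by (intro exI[of _ "p + q + 1"]) auto
  qed
next
  case x: (4 p)
  from assms(3,4) show ?thesis
  proof (cases rule: nonzero_mem_cases)
    case (1 q)
    then show ?thesis using x pos irred by (intro exI[of _ "p + q"]) auto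
  next
    case (2 q)
    then show ?thesis using x pos irred by (intro exI[of _ "p + q + 1"]) auto
  next
    case (3 q)
    then show ?thesis using x pos irred by (intro exI[of _ "p + q + 1"]) auto
  next
    case (4 q)
    then show ?thesis using x pos irred by (intro exI[of _ "p + q + 1"]) auto
  qed
qed

lemma add_mem:
  assumes "x \<in> S" "y \<in> S"
  shows "x + y \<in> S"
proof (cases "x = 0 \<or> y = 0")
  case False
  then have "x \<noteq> 0" "y \<noteq> 0" by simp_all
  from add_nonzero_mem[OF assms(1) this(1) assms(2) this(2)] show ?thesis
    using mem_classes by (elim exE disjE conjE) simp_all
qed (use assms in auto)



text \<open>A gap \<open>z\<close> with \<open>z + 4 \<in> S\<close> lies four below the least element of its class. Conversely, a class
  minimum plus a nonzero element exceeds the minimum of the class of the sum, hence stays in \<open>S\<close> when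
  four is subtracted. The multiple \<open>-4\<close> of four is ruled out by adding \<open>4 k\<^sub>1 + 1\<close>.\<close>

lemma PF_eq: "PF S = {4 * int k1 - 3, 4 * int k2 - 2, 4 * int k3 - 1}"
proof (intro equalityI subsetI)
  fix z assume "z \<in> PF S"
  then have z: "z \<notin> int ` S" "\<And>x. x \<in> S \<Longrightarrow> x \<noteq> 0 \<Longrightarrow> z + int x \<in> int ` S"
    by (auto simp: PF_def)
  have z4: "z + 4 \<in> int ` S" using z(2)[of 4] mem_classes(1)[of 1] by simp
  have z1: "z + (4 * int k1 + 1) \<in> int ` S" using z(2)[of "4 * k1 + 1"] mem_classes(2)[of k1] by (simp add: add.commute)
  have "\<exists>q. z = 4 * q \<or> z = 4 * q + 1 \<or> z = 4 * q + 2 \<or> z = 4 * q + 3" by presburger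
  then obtain q where "z = 4 * q \<or> z = 4 * q + 1 \<or> z = 4 * q + 2 \<or> z = 4 * q + 3" by blast
  then show "z \<in> {4 * int k1 - 3, 4 * int k2 - 2, 4 * int k3 - 1}"
  proof (elim disjE)
    assume q: "z = 4 * q"
    have "z + (4 * int k1 + 1) = 4 * (q + int k1) + 1" "z + 4 = 4 * (q + 1)" using q by auto
    then show ?thesis
      using z(1) z1 z4 q by (simp only: int_mem_classes)
  next
    assume q: "z = 4 * q + 1"
    have "z + 4 = 4 * (q + 1) + 1" using q by auto
    then show ?thesis using z(1) z4 q int_mem_classes(2)[of q] int_mem_classes(2)[of "q + 1"] by auto
  next
    assume q: "z = 4 * q + 2"
    have "z + 4 = 4 * (q + 1) + 2" using q by auto
    then show ?thesis using z(1) z4 q int_mem_classes(3)[of q] int_mem_classes(3)[of "q + 1"] by auto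
  next
    assume q: "z = 4 * q + 3"
    have "z + 4 = 4 * (q + 1) + 3" using q by auto
    then show ?thesis using z(1) z4 q int_mem_classes(4)[of q] int_mem_classes(4)[of "q + 1"] by auto
  qed
next
  fix z assume z: "z \<in> {4 * int k1 - 3, 4 * int k2 - 2, 4 * int k3 - 1}"
  have min: "4 * int k1 - 3 = 4 * (int k1 - 1) + 1" "4 * int k2 - 2 = 4 * (int k2 - 1) + 2"
    "4 * int k3 - 1 = 4 * (int k3 - 1) + 3" by auto
  have "z \<notin> int ` S"
    using z by (elim insertE emptyE) (simp_all only: min int_mem_classes)
  moreover have "z + int x \<in> int ` S" if x: "x \<in> S" "x \<noteq> 0" for x
  proof -
    from z obtain w where w: "w \<in> S" "w \<noteq> 0" "z = int w - 4"
    proof (elim insertE emptyE)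
      assume "z = 4 * int k1 - 3"
      then show thesis using that[of "4 * k1 + 1"] mem_classes(2)[of k1] by auto
    next
      assume "z = 4 * int k2 - 2"
      then show thesis using that[of "4 * k2 + 2"] mem_classes(3)[of k2] by auto
    next
      assume "z = 4 * int k3 - 1"
      then show thesis using that[of "4 * k3 + 3"] mem_classes(4)[of k3] by auto
    qed
    from add_nonzero_mem[OF w(1,2) x] obtain q where
      q: "w + x = 4 * q \<and> 1 < q \<or> w + x = 4 * q + 1 \<and> k1 < q
        \<or> w + x = 4 * q + 2 \<and> k2 < q \<or> w + x = 4 * q + 3 \<and> k3 < q" by blast
    have "z + int x = int (w + x) - 4" using w(3) by simp
    also have "\<dots> \<in> int ` S"
      using q
    proof (elim disjE conjE)
      assume *: "w + x = 4 * q" "1 < q"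
      have "int (w + x) - 4 = 4 * (int q - 1)" unfolding *(1) by simp
      then show ?thesis using *(2) by (simp only: int_mem_classes)
    next
      assume *: "w + x = 4 * q + 1" "k1 < q"
      have "int (w + x) - 4 = 4 * (int q - 1) + 1" unfolding *(1) by simp
      then show ?thesis using *(2) by (simp only: int_mem_classes)
    next
      assume *: "w + x = 4 * q + 2" "k2 < q"
      have "int (w + x) - 4 = 4 * (int q - 1) + 2" unfolding *(1) by simp
      then show ?thesis using *(2) by (simp only: int_mem_classes)
    next
      assume *: "w + x = 4 * q + 3" "k3 < q"
      have "int (w + x) - 4 = 4 * (int q - 1) + 3" unfolding *(1) by simp
      then show ?thesis using *(2) by (simp only: int_mem_classes)
    qed
    finally show ?thesis .
  qed
  ultimately show "z \<in> PF S" by (simp add: PF_def)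
qed

text \<open>Every element is zero or the least element of its class, plus a multiple of four.\<close>

lemma generated_eq: "S = generated {4, 4 * k1 + 1, 4 * k2 + 2, 4 * k3 + 3}" (is "S = generated ?G")
proof
  have zero: "0 \<in> S" using mem_classes(1)[of 0] by simp
  have "?G \<subseteq> S" using mem_classes(1)[of 1] mem_classes(2-4) by simp
  then show "generated ?G \<subseteq> S" using zero by (rule generated_least) (rule add_mem)
  show "S \<subseteq> generated ?G"
  proof
    fix x assume "x \<in> S"
    then obtain q where q: "x = 4 * q \<or> x = 4 * q + 1 \<and> k1 \<le> q \<or> x = 4 * q + 2 \<and> k2 \<le> q \<or> x = 4 * q + 3 \<and> k3 \<le> q"
      unfolding mem_iff by blast
    have "\<exists>n. \<exists>w\<in>insert 0 ?G. x = n * 4 + w"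
      using q
    proof (elim disjE conjE)
      show ?thesis if "x = 4 * q" using that by (intro exI[of _ q] bexI[of _ 0]) auto
      show ?thesis if "x = 4 * q + 1" "k1 \<le> q"
        using that by (intro exI[of _ "q - k1"] bexI[of _ "4 * k1 + 1"]) auto
      show ?thesis if "x = 4 * q + 2" "k2 \<le> q"
        using that by (intro exI[of _ "q - k2"] bexI[of _ "4 * k2 + 2"]) auto
      show ?thesis if "x = 4 * q + 3" "k3 \<le> q"
        using that by (intro exI[of _ "q - k3"] bexI[of _ "4 * k3 + 3"]) auto
    qed
    then obtain n w where x: "x = n * 4 + w" and w: "w \<in> insert 0 ?G" by blast
    have "w \<in> generated ?G"
      using w zero_in_generated[of ?G] subsetD[OF subset_generated, of w ?G] by (elim insertE[of _ 0]) simp_all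
    moreover have "n * 4 \<in> generated ?G"
      by (intro mult_in_generated subsetD[OF subset_generated]) simp
    ultimately show "x \<in> generated ?G" unfolding x by (rule add_in_generated[rotated])
  qed
qed

lemma minimal_generating_set_iff: "minimal_generating_set S A \<longleftrightarrow> A = {4, 4 * k1 + 1, 4 * k2 + 2, 4 * k3 + 3}"
proof (rule minimal_generating_set_iff_atoms)
  show "generated {4, 4 * k1 + 1, 4 * k2 + 2, 4 * k3 + 3} = S"
    by (rule generated_eq[symmetric])
  show "y = 0 \<or> z = 0"
    if g: "g \<in> {4, 4 * k1 + 1, 4 * k2 + 2, 4 * k3 + 3}" "y \<in> S" "z \<in> S" "g = y + z" for g y z
  proof (rule ccontr)
    assume n: "\<not> (y = 0 \<or> z = 0)"
    have "y \<noteq> 0" "z \<noteq> 0" using n by simp_all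
    then obtain q where
      q: "y + z = 4 * q \<and> 1 < q \<or> y + z = 4 * q + 1 \<and> k1 < q
        \<or> y + z = 4 * q + 2 \<and> k2 < q \<or> y + z = 4 * q + 3 \<and> k3 < q"
      using add_nonzero_mem[OF g(2) _ g(3)] by metis
    have "g = 4 * 1 \<or> g = 4 * k1 + 1 \<or> g = 4 * k2 + 2 \<or> g = 4 * k3 + 3"
      using g(1) by auto
    with q show False
      unfolding g(4) by (elim disjE conjE; presburger)
  qed
qed simp

end

section \<open>Row-factorization matrices as four independent factorizations\<close>

definition factorizations :: "int \<Rightarrow> int \<Rightarrow> int \<Rightarrow> int \<Rightarrow> (int \<times> int \<times> int) set" where
  "factorizations x y z v = {(p, q, r). 0 \<le> p \<and> 0 \<le> q \<and> 0 \<le> r \<and> p * x + q * y + r * z = v}"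

text \<open>Each row of a row-factorization matrix of \<open>f\<close> amounts to a factorization of
  \<open>f + n\<^sub>i\<close> over the three other generators, and the rows can be chosen independently.\<close>

lemma row_factorization_matrices_four_generators:
  assumes min: "\<And>A. minimal_generating_set S A \<longleftrightarrow> A = {n1, n2, n3, n4}"
    and less: "n1 < n2" "n2 < n3" "n3 < n4" and "f \<in> PF S"
  shows "{M. row_factorization_matrix S f M} =
    {mat_of_rows_list 4 [[-1, a12, a13, a14], [a21, -1, a23, a24], [a31, a32, -1, a34], [a41, a42, a43, -1]]
     | a12 a13 a14 a21 a23 a24 a31 a32 a34 a41 a42 a43.
       (a12, a13, a14) \<in> factorizations (int n2) (int n3) (int n4) (f + int n1) \<and>
       (a21, a23, a24) \<in> factorizations (int n1) (int n3) (int n4) (f + int n2) \<and>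
       (a31, a32, a34) \<in> factorizations (int n1) (int n2) (int n4) (f + int n3) \<and>
       (a41, a42, a43) \<in> factorizations (int n1) (int n2) (int n3) (f + int n4)}"
    (is "?L = ?R")
proof -
  let ?ns = "[n1, n2, n3, n4]"
  have ns: "sorted_wrt (<) ns \<and> set ns = {n1, n2, n3, n4} \<longleftrightarrow> ns = ?ns" for ns
  proof
    assume a: "sorted_wrt (<) ns \<and> set ns = {n1, n2, n3, n4}"
    show "ns = ?ns"
      by (rule strict_sorted_equal[symmetric]) (use a less in auto)
  qed (use less in auto)
  have less4: "(\<forall>i<4. P i) \<longleftrightarrow> P 0 \<and> P 1 \<and> P 2 \<and> P 3" for P :: "nat \<Rightarrow> bool"
    by (auto simp: numeral_eq_Suc less_Suc_eq)
  have "row_factorization_matrix S f M \<longleftrightarrow>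
      (\<exists>ns. ns = ?ns \<and> M \<in> carrier_mat (length ns) (length ns) \<and>
        (\<forall>i < length ns. M $$ (i, i) = -1) \<and>
        (\<forall>i < length ns. \<forall>j < length ns. i \<noteq> j \<longrightarrow> M $$ (i, j) \<ge> 0) \<and>
        (\<forall>i < length ns. f = (\<Sum>j < length ns. M $$ (i, j) * int (ns ! j))))" for M
    unfolding row_factorization_matrix_def min ns[symmetric] using assms(5) by blast
  then have rfm: "row_factorization_matrix S f M \<longleftrightarrow> M \<in> carrier_mat 4 4 \<and>
      (\<forall>i < 4. M $$ (i, i) = -1) \<and>
      (\<forall>i < 4. \<forall>j < 4. i \<noteq> j \<longrightarrow> M $$ (i, j) \<ge> 0) \<and>
      (\<forall>i < 4. f = M $$ (i, 0) * int n1 + M $$ (i, 1) * int n2 + M $$ (i, 2) * int n3 + M $$ (i, 3) * int n4)" for M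
    by (simp add: numeral_eq_Suc lessThan_Suc algebra_simps)
  show ?thesis
  proof (intro equalityI subsetI)
    fix M assume "M \<in> ?L"
    then have M: "M \<in> carrier_mat 4 4" "\<forall>i<4. M $$ (i, i) = -1"
      "\<forall>i<4. \<forall>j<4. i \<noteq> j \<longrightarrow> M $$ (i, j) \<ge> 0"
      "\<forall>i < 4. f = M $$ (i, 0) * int n1 + M $$ (i, 1) * int n2 + M $$ (i, 2) * int n3 + M $$ (i, 3) * int n4"
      unfolding mem_Collect_eq rfm by blast+
    have diag: "M $$ (0, 0) = -1" "M $$ (1, 1) = -1" "M $$ (2, 2) = -1" "M $$ (3, 3) = -1"
      using M(2) unfolding less4 by blast+
    have off: "M $$ (i, j) \<ge> 0" if "i < 4" "j < 4" "i \<noteq> j" for i j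
      using M(3) that by blast
    have row: "f = M $$ (i, 0) * int n1 + M $$ (i, 1) * int n2 + M $$ (i, 2) * int n3 + M $$ (i, 3) * int n4"
      if "i < 4" for i using M(4) that by blast
    let ?rows = "[[-1, M $$ (0,1), M $$ (0,2), M $$ (0,3)], [M $$ (1,0), -1, M $$ (1,2), M $$ (1,3)],
       [M $$ (2,0), M $$ (2,1), -1, M $$ (2,3)], [M $$ (3,0), M $$ (3,1), M $$ (3,2), -1]]"
    have "M = mat_of_rows_list 4 ?rows"
    proof (rule eq_matI)
      have "\<forall>i<4. \<forall>j<4. M $$ (i, j) = mat_of_rows_list 4 ?rows $$ (i, j)"
        using diag unfolding less4 by (simp add: mat_of_rows_list_def)
      moreover have "dim_row (mat_of_rows_list 4 ?rows) = 4" "dim_col (mat_of_rows_list 4 ?rows) = 4"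
        by (simp_all add: mat_of_rows_list_def)
      ultimately show "M $$ (i, j) = mat_of_rows_list 4 ?rows $$ (i, j)"
        if "i < dim_row (mat_of_rows_list 4 ?rows)" "j < dim_col (mat_of_rows_list 4 ?rows)" for i j
        using that by metis
    qed (use M(1) in \<open>simp_all add: mat_of_rows_list_def\<close>)
    moreover have
      "(M $$ (0,1), M $$ (0,2), M $$ (0,3)) \<in> factorizations (int n2) (int n3) (int n4) (f + int n1)"
      "(M $$ (1,0), M $$ (1,2), M $$ (1,3)) \<in> factorizations (int n1) (int n3) (int n4) (f + int n2)"
      "(M $$ (2,0), M $$ (2,1), M $$ (2,3)) \<in> factorizations (int n1) (int n2) (int n4) (f + int n3)"
      "(M $$ (3,0), M $$ (3,1), M $$ (3,2)) \<in> factorizations (int n1) (int n2) (int n3) (f + int n4)"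
      using off row[of 0] row[of 1] row[of 2] row[of 3]
      unfolding factorizations_def diag by simp_all
    ultimately show "M \<in> ?R" by blast
  next
    fix M assume "M \<in> ?R"
    then obtain a12 a13 a14 a21 a23 a24 a31 a32 a34 a41 a42 a43 where
      M: "M = mat_of_rows_list 4 [[-1, a12, a13, a14], [a21, -1, a23, a24], [a31, a32, -1, a34], [a41, a42, a43, -1]]"
      and fac: "(a12, a13, a14) \<in> factorizations (int n2) (int n3) (int n4) (f + int n1)"
       "(a21, a23, a24) \<in> factorizations (int n1) (int n3) (int n4) (f + int n2)"
       "(a31, a32, a34) \<in> factorizations (int n1) (int n2) (int n4) (f + int n3)"
       "(a41, a42, a43) \<in> factorizations (int n1) (int n2) (int n3) (f + int n4)"
      by blast
    have carrier: "M \<in> carrier_mat 4 4"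
      unfolding M by (rule carrier_matI) (simp_all add: mat_of_rows_list_def)
    have entries:
      "M $$ (0, 0) = -1" "M $$ (0, 1) = a12" "M $$ (0, 2) = a13" "M $$ (0, 3) = a14"
      "M $$ (1, 0) = a21" "M $$ (1, 1) = -1" "M $$ (1, 2) = a23" "M $$ (1, 3) = a24"
      "M $$ (2, 0) = a31" "M $$ (2, 1) = a32" "M $$ (2, 2) = -1" "M $$ (2, 3) = a34"
      "M $$ (3, 0) = a41" "M $$ (3, 1) = a42" "M $$ (3, 2) = a43" "M $$ (3, 3) = -1"
      unfolding M by (simp_all add: mat_of_rows_list_def)
    show "M \<in> ?L"
      unfolding mem_Collect_eq rfm less4 entries
      using fac carrier unfolding factorizations_def mem_Collect_eq prod.case
      by (simp del: mult_minus1 add: algebra_simps)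
  qed
qed

section \<open>Factorizations over three generators\<close>

text \<open>Both of the last two generators are at least \<open>n\<close>, so together they can be used fewer than \<open>c\<close> times
  in a target below \<open>c n\<close>.\<close>

lemma coefficient_sum_less:
  fixes p q r x y z n c v :: int
  assumes "0 \<le> p" "0 \<le> q" "0 \<le> r" "0 \<le> x" "0 < n" "n \<le> y" "n \<le> z"
    and "p * x + q * y + r * z = v" "v < c * n"
  shows "q + r < c"
proof -
  have "0 \<le> p * x" "q * n \<le> q * y" "r * n \<le> r * z"
    using assms(1-7) by (simp_all add: mult_left_mono)
  then have "(q + r) * n < c * n" using assms(8,9) by (simp add: distrib_right)
  then show ?thesis using \<open>0 < n\<close> by simp
qed

text \<open>The next three lemmas express that an irreducible target factors over generators containing it only
  as itself. They differ in the position of the target and hence in what excludes other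
  representations: size alone, divisibility by the smaller generator, or an explicit
  hypothesis.\<close>

lemma factorizations_first:
  assumes "0 < x" "x < y" "x < z"
  shows "factorizations x y z x = {(1, 0, 0)}"
proof -
  have "p = 1 \<and> q = 0 \<and> r = 0" if "0 \<le> p" "0 \<le> q" "0 \<le> r" "p * x + q * y + r * z = x" for p q r
  proof -
    have "q + r < 1"
      using coefficient_sum_less[of p q r x "x + 1" y z x 1] that assms by simp
    then have "q = 0" "r = 0" using that by auto
    with that assms show ?thesis by simp
  qed
  then show ?thesis by (auto simp: factorizations_def)
qed

lemma factorizations_second:
  assumes "0 < x" "x < y" "y < z" "\<not> x dvd y"
  shows "factorizations x y z y = {(0, 1, 0)}"
proof -
  have "p = 0 \<and> q = 1 \<and> r = 0" if "0 \<le> p" "0 \<le> q" "0 \<le> r" "p * x + q * y + r * z = y" for p q r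
  proof -
    have "q + r < 2"
      using coefficient_sum_less[of p q r x y y z y 2] that assms by simp
    then have "q = 0 \<and> r = 0 \<or> q = 1 \<and> r = 0 \<or> q = 0 \<and> r = 1"
      using that(2,3) by linarith
    then consider "q = 0" "r = 0" | "q = 1" "r = 0" | "q = 0" "r = 1" by blast
    then show ?thesis
    proof cases
      case 1
      with that have "y = x * p" by (simp add: mult.commute)
      with assms(4) show ?thesis by simp
    next
      case 2
      with that assms show ?thesis by simp
    next
      case 3
      moreover from this have "p * x + z = y" using that by simp
      moreover have "0 \<le> p * x" using that assms by simp
      ultimately show ?thesis using assms(3) by linarith
    qed
  qed
  then show ?thesis by (auto simp: factorizations_def)
qed

lemma factorizations_third:
  assumes "0 < x" "0 < y" "0 < z" and "\<And>p q. 0 \<le> p \<Longrightarrow> 0 \<le> q \<Longrightarrow> p * x + q * y \<noteq> z"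
  shows "factorizations x y z z = {(0, 0, 1)}"
proof -
  have "p = 0 \<and> q = 0 \<and> r = 1" if "0 \<le> p" "0 \<le> q" "0 \<le> r" "p * x + q * y + r * z = z" for p q r
  proof -
    have nonneg: "0 \<le> p * x" "0 \<le> q * y" using that assms by auto
    have "r \<noteq> 0" using assms(4)[of p q] that by auto
    moreover have "r * z < 2 * z" using that(4) nonneg assms(3) by linarith
    then have "r < 2" using assms(3) by simp
    ultimately have r: "r = 1" using that(3) by linarith
    then have "p * x + q * y = 0" using that(4) by simp
    then have "p * x = 0" "q * y = 0" using nonneg by linarith+
    with r assms(1,2) show ?thesis by simp
  qed
  then show ?thesis by (auto simp: factorizations_def)
qed

text \<open>With the two large generators used at most twice in total, six shapes remain, and in each the
  coefficient of four is determined. Stating them as equations for \<open>4 p\<close> reduces each later instance to a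
  divisibility test.\<close>

lemma factorizations_four_small:
  assumes "0 < n" "n \<le> y" "n \<le> z" "v < 3 * n"
  shows "factorizations 4 y z v = {(p, q, r). 0 \<le> p \<and>
    (q = 0 \<and> r = 0 \<and> 4 * p = v \<or> q = 1 \<and> r = 0 \<and> 4 * p = v - y \<or> q = 0 \<and> r = 1 \<and> 4 * p = v - z \<or>
     q = 2 \<and> r = 0 \<and> 4 * p = v - 2 * y \<or> q = 1 \<and> r = 1 \<and> 4 * p = v - y - z \<or> q = 0 \<and> r = 2 \<and> 4 * p = v - 2 * z)}"
    (is "_ = ?R")
proof (intro equalityI subsetI)
  fix t assume "t \<in> factorizations 4 y z v"
  then obtain p q r where t: "t = (p, q, r)" and
    f: "0 \<le> p" "0 \<le> q" "0 \<le> r" "p * 4 + q * y + r * z = v"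
    by (auto simp: factorizations_def)
  have "q + r < 3"
    using coefficient_sum_less[of p q r 4 n y z v 3] f assms by simp
  then have "q = 0 \<and> r = 0 \<or> q = 1 \<and> r = 0 \<or> q = 0 \<and> r = 1 \<or> q = 2 \<and> r = 0 \<or> q = 1 \<and> r = 1 \<or> q = 0 \<and> r = 2"
    using f(2,3) by presburger
  then show "t \<in> ?R" unfolding t mem_Collect_eq prod.case using f(1,4) by (elim disjE conjE) simp_all
next
  fix t assume "t \<in> ?R"
  moreover obtain p q r where t: "t = (p, q, r)" by (rule prod_cases3)
  ultimately show "t \<in> factorizations 4 y z v"
    unfolding t factorizations_def mem_Collect_eq prod.case by (elim disjE conjE) simp_all
qed

text \<open>What is left of \<open>4 p + (4 k + 2) q + z r = v\<close> with \<open>z\<close> odd once \<open>r\<close> is known: half of the equation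
  in the two even generators, whose halves \<open>2\<close> and \<open>2 k + 1\<close> are coprime.\<close>

definition half_factorizations :: "int \<Rightarrow> int \<Rightarrow> (int \<times> int) set" where
  "half_factorizations k u = {(p, q). 0 \<le> p \<and> 0 \<le> q \<and> 2 * p + (2 * k + 1) * q = u}"

text \<open>The coefficient of the only odd generator has the parity of the target, and size leaves one odd
  value.\<close>

lemma factorizations_odd_target:
  assumes "0 \<le> k" "odd z" "0 < z" "v = 2 * u + z" "v < 3 * z"
  shows "factorizations 4 (4 * k + 2) z v = {(p, q, 1) | p q. (p, q) \<in> half_factorizations k u}"
    (is "_ = ?R")
proof (intro equalityI subsetI)
  fix t assume "t \<in> factorizations 4 (4 * k + 2) z v"
  then obtain p q r where t: "t = (p, q, r)" and
    f: "0 \<le> p" "0 \<le> q" "0 \<le> r" "p * 4 + q * (4 * k + 2) + r * z = v"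
    by (auto simp: factorizations_def)
  have "0 \<le> q * (4 * k + 2)" using f assms by simp
  then have "r * z < 3 * z" using f assms by linarith
  then have "r < 3" using assms by simp
  moreover have "odd (p * 4 + q * (4 * k + 2) + r * z)" unfolding f(4) assms(4) using assms(2) by simp
  then have "odd r" using assms(2) by simp
  ultimately have r: "r = 1" using f(3) by presburger
  then have "2 * (2 * p + (2 * k + 1) * q) = 2 * u" using f(4) assms(4) by (simp add: algebra_simps)
  then show "t \<in> ?R" using f r unfolding t half_factorizations_def by simp
next
  fix t assume "t \<in> ?R"
  then obtain p q where t: "t = (p, q, 1)" "0 \<le> p" "0 \<le> q" "2 * p + (2 * k + 1) * q = u"
    by (auto simp: half_factorizations_def)
  from t(4) have "p * 4 + q * (4 * k + 2) = 2 * u" by (simp add: algebra_simps)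
  then show "t \<in> factorizations 4 (4 * k + 2) z v" using t assms(4) by (simp add: factorizations_def)
qed

text \<open>For an even target the odd generator occurs an even number of times; two occurrences already use
  up the largest target considered, which is the source of the exceptional row \<open>(0, 0, 2)\<close>.\<close>

lemma factorizations_even_target:
  assumes "0 \<le> k" "odd z" "0 < z" "v = 2 * u" "v \<le> 2 * z"
  shows "factorizations 4 (4 * k + 2) z v =
    {(p, q, 0) | p q. (p, q) \<in> half_factorizations k u} \<union> (if v = 2 * z then {(0, 0, 2)} else {})"
    (is "_ = ?R")
proof (intro equalityI subsetI)
  fix t assume "t \<in> factorizations 4 (4 * k + 2) z v"
  then obtain p q r where t: "t = (p, q, r)" and
    f: "0 \<le> p" "0 \<le> q" "0 \<le> r" "p * 4 + q * (4 * k + 2) + r * z = v"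
    by (auto simp: factorizations_def)
  have nonneg: "0 \<le> q * (4 * k + 2)" using f assms by simp
  then have "r * z < 3 * z" using f assms by linarith
  then have "r < 3" using assms by simp
  moreover have "even (p * 4 + q * (4 * k + 2) + r * z)" unfolding f(4) assms(4) by simp
  then have "even r" using assms(2) by simp
  ultimately have "r = 0 \<or> r = 2" using f(3) by presburger
  then consider "r = 0" | "r = 2" by blast
  then show "t \<in> ?R"
  proof cases
    case 1
    then have "2 * (2 * p + (2 * k + 1) * q) = 2 * u" using f(4) assms(4) by (simp add: algebra_simps)
    then show ?thesis using f 1 unfolding t half_factorizations_def by simp
  next
    case 2
    then have "p * 4 + q * (4 * k + 2) + 2 * z = v" using f(4) by simp
    then have "p = 0" "q * (4 * k + 2) = 0" "v = 2 * z" using f(1) nonneg assms(5) by linarith+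
    moreover from this have "q = 0" using assms(1) by auto
    ultimately show ?thesis using 2 unfolding t by simp
  qed
next
  fix t assume "t \<in> ?R"
  then consider p q where "t = (p, q, 0)" "0 \<le> p" "0 \<le> q" "2 * p + (2 * k + 1) * q = u" | "t = (0, 0, 2)" "v = 2 * z"
    by (auto simp: half_factorizations_def split: if_splits)
  then show "t \<in> factorizations 4 (4 * k + 2) z v"
  proof cases
    case (1 p q)
    from 1(4) have "p * 4 + q * (4 * k + 2) = 2 * u" by (simp add: algebra_simps)
    then show ?thesis using 1 assms(4) by (simp add: factorizations_def)
  qed (simp add: factorizations_def)
qed

lemma half_factorizations_small:
  assumes "0 \<le> k" "0 \<le> t" "t \<le> k"
  shows "half_factorizations k (2 * t) = {(t, 0)}"
proof -
  have "p = t \<and> q = 0" if "0 \<le> p" "0 \<le> q" "2 * p + (2 * k + 1) * q = 2 * t" for p q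
  proof -
    have "(2 * k + 1) * q < (2 * k + 1) * 1" unfolding mult_1_right using that(1,3) assms(3) by linarith
    then have "q < 1" using mult_less_cancel_left_pos[of "2 * k + 1" q 1] assms(1) by simp
    then have "q = 0" using that(2) by simp
    with that show ?thesis by simp
  qed
  then show ?thesis using assms by (auto simp: half_factorizations_def)
qed

text \<open>Since \<open>2 k + 1\<close> is odd, its coefficient has the parity of the target. The side condition on the
  parameter says that the other coefficient is nonnegative.\<close>

lemma half_factorizations_even:
  "half_factorizations k (2 * t) =
    {(t - int b - 2 * int b * k, 2 * int b) | b. 2 * int b * (2 * k + 1) \<le> 2 * t}" (is "_ = ?R")
proof (intro equalityI subsetI)
  fix x assume "x \<in> half_factorizations k (2 * t)"
  then obtain p q where x: "x = (p, q)" and f: "0 \<le> p" "0 \<le> q" "2 * p + (2 * k + 1) * q = 2 * t"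
    by (auto simp: half_factorizations_def)
  have "even (2 * p + (2 * k + 1) * q)" unfolding f(3) by simp
  then have "even q" by simp
  then obtain c where c: "q = 2 * c" by (rule evenE)
  define b where "b = nat c"
  have q: "q = 2 * int b" using f(2) c unfolding b_def by simp
  have "p = t - int b - 2 * int b * k" using f(3) unfolding q by (simp add: algebra_simps)
  moreover from this f(1) have "2 * int b * (2 * k + 1) \<le> 2 * t" by (simp add: algebra_simps)
  ultimately show "x \<in> ?R" unfolding x q by blast
next
  fix x assume "x \<in> ?R"
  then show "x \<in> half_factorizations k (2 * t)"
    by (auto simp: half_factorizations_def algebra_simps)
qed

lemma half_factorizations_odd:
  "half_factorizations k (2 * t - 1) =
    {(t - int a - (2 * int a - 1) * k, 2 * int a - 1) | a. 1 \<le> a \<and> 2 * int a * (2 * k + 1) \<le> 2 * t + 2 * k}" (is "_ = ?R")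
proof (intro equalityI subsetI)
  fix x assume "x \<in> half_factorizations k (2 * t - 1)"
  then obtain p q where x: "x = (p, q)" and f: "0 \<le> p" "0 \<le> q" "2 * p + (2 * k + 1) * q = 2 * t - 1"
    by (auto simp: half_factorizations_def)
  have "odd (2 * p + (2 * k + 1) * q)" unfolding f(3) by simp
  then have "odd q" by simp
  then obtain c where c: "q = 2 * c + 1" by (rule oddE)
  define a where "a = nat (c + 1)"
  have q: "1 \<le> a" "q = 2 * int a - 1" using f(2) c unfolding a_def by auto
  have "p = t - int a - (2 * int a - 1) * k" using f(3) unfolding q by (simp add: algebra_simps)
  moreover from this f(1) have "2 * int a * (2 * k + 1) \<le> 2 * t + 2 * k" by (simp add: algebra_simps)
  ultimately show "x \<in> ?R" using q(1) unfolding x q(2) by blast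
next
  fix x assume "x \<in> ?R"
  then show "x \<in> half_factorizations k (2 * t - 1)"
    by (auto simp: half_factorizations_def algebra_simps)
qed

section \<open>The rows when the conductor is two modulo four\<close>

context
  fixes k m x y z v t :: int
  assumes k: "1 \<le> k" "k \<le> m"
begin

text \<open>Every pseudo-Frobenius number is a generator minus four, so the first row of its matrices factors a
  generator over itself and two others. Both larger generators are odd while \<open>4 k + 2\<close> is even and
  exceeds their difference.\<close>

lemma first_row_2_mod_4:
  assumes "x = 4 * k + 2" "y = 4 * m + 3" "z = 4 * m + 5"
  shows "factorizations x y z x = {(1, 0, 0)}"
    and "factorizations x y z y = {(0, 1, 0)}"
    and "factorizations x y z z = {(0, 0, 1)}"
proof -
  show "factorizations x y z x = {(1, 0, 0)}"
    using k assms by (intro factorizations_first) auto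
  have even: "even x" and odd: "odd y" "odd z" using assms by simp_all
  have "\<not> x dvd y" using even odd dvd_trans by blast
  then show "factorizations x y z y = {(0, 1, 0)}"
    using k assms by (intro factorizations_second) auto
  have "p * x + q * y \<noteq> z" if "0 \<le> p" "0 \<le> q" for p q
  proof
    assume eq: "p * x + q * y = z"
    then have "odd (p * x + q * y)" using odd by simp
    then have "odd q" using even by simp
    have px: "0 \<le> p * x" using that k assms by simp
    then have "q * y < 2 * y" using eq k assms by linarith
    then have "q < 2" using mult_less_cancel_right_pos[of y q 2] k assms by simp
    with \<open>odd q\<close> that have "q = 1" by presburger
    then have "p * (4 * k + 2) = 2" using eq assms by simp
    moreover have "p * 6 \<le> p * (4 * k + 2)" using that k by (intro mult_left_mono) auto
    ultimately have "p = 0" using that by simp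
    with \<open>p * (4 * k + 2) = 2\<close> show False by simp
  qed
  then show "factorizations x y z z = {(0, 0, 1)}"
    using k assms by (intro factorizations_third) auto
qed

text \<open>Only four and the two generators above the conductor are available here, so the targets are small
  multiples of the latter and congruences modulo four select the shape.\<close>

lemma second_row_2_mod_4:
  assumes "x = 4" "y = 4 * m + 3" "z = 4 * m + 5"
  shows "v = 8 * k \<Longrightarrow> factorizations x y z v = {(2 * k, 0, 0)}"
    and "v = 4 * m + 4 * k + 1 \<Longrightarrow> factorizations x y z v = {(k - 1, 0, 1)}"
    and "v = 4 * m + 4 * k + 3 \<Longrightarrow> factorizations x y z v = {(k, 1, 0)}"
proof -
  note small = factorizations_four_small[of y y z v]
  have y: "0 < y" "y \<le> y" "y \<le> z" using k assms by simp_all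
  show "factorizations x y z v = {(2 * k, 0, 0)}" if v: "v = 8 * k"
  proof -
    have "v < 3 * y" using k assms(2) v by simp
    note eq = small[OF y this]
    show ?thesis
      unfolding assms(1) eq unfolding assms(2,3) v using k
      by (intro equalityI subsetI, (elim CollectE case_prodE conjE disjE; simp; presburger), simp)
  qed
  show "factorizations x y z v = {(k - 1, 0, 1)}" if v: "v = 4 * m + 4 * k + 1"
  proof -
    have "v < 3 * y" using k assms(2) v by simp
    note eq = small[OF y this]
    show ?thesis
      unfolding assms(1) eq unfolding assms(2,3) v using k
      by (intro equalityI subsetI, (elim CollectE case_prodE conjE disjE; simp; presburger), simp)
  qed
  show "factorizations x y z v = {(k, 1, 0)}" if v: "v = 4 * m + 4 * k + 3"
  proof -
    have "v < 3 * y" using k assms(2) v by simp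
    note eq = small[OF y this]
    show ?thesis
      unfolding assms(1) eq unfolding assms(2,3) v using k
      by (intro equalityI subsetI, (elim CollectE case_prodE conjE disjE; simp; presburger), simp)
  qed
qed

text \<open>Here \<open>t\<close> stands for half of the conductor \<open>4 m + 2\<close>. The parametric families arise because the even
  target leaves only the two even generators.\<close>

lemma third_row_2_mod_4:
  assumes "x = 4" "y = 4 * k + 2" "z = 4 * m + 5" "t = 2 * m + 1"
  shows "v = 4 * k + 4 * m + 1 \<Longrightarrow> factorizations x y z v = {(k - 1, 0, 1)}"
    and "v = 8 * m + 2 \<Longrightarrow> factorizations x y z v =
      {(t - int a - (2 * int a - 1) * k, 2 * int a - 1, 0) | a. 1 \<le> a \<and> 2 * int a * (2 * k + 1) \<le> 2 * t + 2 * k}"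
    and "v = 8 * m + 4 \<Longrightarrow> factorizations x y z v =
      {(t - int b - 2 * int b * k, 2 * int b, 0) | b. 2 * int b * (2 * k + 1) \<le> 2 * t}"
proof -
  have z: "odd z" "0 < z" using assms(3) k by auto
  show "factorizations x y z v = {(k - 1, 0, 1)}" if "v = 4 * k + 4 * m + 1"
  proof -
    have "factorizations x y z v = {(p, q, 1) | p q. (p, q) \<in> half_factorizations k (2 * (k - 1))}"
      unfolding assms(1,2) using k z assms that by (intro factorizations_odd_target) auto
    also have "half_factorizations k (2 * (k - 1)) = {(k - 1, 0)}"
      using k by (intro half_factorizations_small) auto
    finally show ?thesis by auto
  qed
  show "factorizations x y z v =
      {(t - int a - (2 * int a - 1) * k, 2 * int a - 1, 0) | a. 1 \<le> a \<and> 2 * int a * (2 * k + 1) \<le> 2 * t + 2 * k}"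
    if "v = 8 * m + 2"
  proof -
    have "factorizations x y z v = {(p, q, 0) | p q. (p, q) \<in> half_factorizations k (2 * t - 1)}"
      unfolding assms(1,2) using factorizations_even_target[of k z v "2 * t - 1"] k z assms that by auto
    also have "half_factorizations k (2 * t - 1) = {(t - int a - (2 * int a - 1) * k, 2 * int a - 1) | a.
        1 \<le> a \<and> 2 * int a * (2 * k + 1) \<le> 2 * t + 2 * k}"
      by (rule half_factorizations_odd)
    finally show ?thesis by auto
  qed
  show "factorizations x y z v =
      {(t - int b - 2 * int b * k, 2 * int b, 0) | b. 2 * int b * (2 * k + 1) \<le> 2 * t}"
    if "v = 8 * m + 4"
  proof -
    have "factorizations x y z v = {(p, q, 0) | p q. (p, q) \<in> half_factorizations k (2 * t)}"
      unfolding assms(1,2) using factorizations_even_target[of k z v "2 * t"] k z assms that by auto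
    also have "half_factorizations k (2 * t) = {(t - int b - 2 * int b * k, 2 * int b) | b.
        2 * int b * (2 * k + 1) \<le> 2 * t}"
      by (rule half_factorizations_even)
    finally show ?thesis by auto
  qed
qed

text \<open>Compared with the third row the odd generator is smaller, and the last target \<open>8 m + 6\<close> is exactly
  its double.\<close>

lemma fourth_row_2_mod_4:
  assumes "x = 4" "y = 4 * k + 2" "z = 4 * m + 3" "t = 2 * m + 1"
  shows "v = 4 * k + 4 * m + 3 \<Longrightarrow> factorizations x y z v = {(k, 0, 1)}"
    and "v = 8 * m + 4 \<Longrightarrow> factorizations x y z v =
      {(t - int b - 2 * int b * k, 2 * int b, 0) | b. 2 * int b * (2 * k + 1) \<le> 2 * t}"
    and "v = 8 * m + 6 \<Longrightarrow> factorizations x y z v =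
      {(t - int a + 1 - (2 * int a - 1) * k, 2 * int a - 1, 0) | a. 1 \<le> a \<and> 2 * int a * (2 * k + 1) \<le> 2 * t + 2 * k + 2}
      \<union> {(0, 0, 2)}"
proof -
  have z: "odd z" "0 < z" using assms(3) k by auto
  show "factorizations x y z v = {(k, 0, 1)}" if "v = 4 * k + 4 * m + 3"
  proof -
    have "factorizations x y z v = {(p, q, 1) | p q. (p, q) \<in> half_factorizations k (2 * k)}"
      unfolding assms(1,2) using k z assms that by (intro factorizations_odd_target) auto
    also have "half_factorizations k (2 * k) = {(k, 0)}"
      using k by (intro half_factorizations_small) auto
    finally show ?thesis by auto
  qed
  show "factorizations x y z v =
      {(t - int b - 2 * int b * k, 2 * int b, 0) | b. 2 * int b * (2 * k + 1) \<le> 2 * t}"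
    if "v = 8 * m + 4"
  proof -
    have "factorizations x y z v = {(p, q, 0) | p q. (p, q) \<in> half_factorizations k (2 * t)}"
      unfolding assms(1,2) using factorizations_even_target[of k z v "2 * t"] k z assms that by auto
    also have "half_factorizations k (2 * t) = {(t - int b - 2 * int b * k, 2 * int b) | b.
        2 * int b * (2 * k + 1) \<le> 2 * t}"
      by (rule half_factorizations_even)
    finally show ?thesis by auto
  qed
  show "factorizations x y z v =
      {(t - int a + 1 - (2 * int a - 1) * k, 2 * int a - 1, 0) | a. 1 \<le> a \<and> 2 * int a * (2 * k + 1) \<le> 2 * t + 2 * k + 2}
      \<union> {(0, 0, 2)}"
    if "v = 8 * m + 6"
  proof -
    have "factorizations x y z v = {(p, q, 0) | p q. (p, q) \<in> half_factorizations k (2 * (t + 1) - 1)} \<union> {(0, 0, 2)}"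
      unfolding assms(1,2) using factorizations_even_target[of k z v "2 * (t + 1) - 1"] k z assms that by auto
    also have "half_factorizations k (2 * (t + 1) - 1) = {(t + 1 - int a - (2 * int a - 1) * k, 2 * int a - 1) | a.
        1 \<le> a \<and> 2 * int a * (2 * k + 1) \<le> 2 * (t + 1) + 2 * k}"
      by (rule half_factorizations_odd)
    also have "\<dots> = {(t - int a + 1 - (2 * int a - 1) * k, 2 * int a - 1) | a.
        1 \<le> a \<and> 2 * int a * (2 * k + 1) \<le> 2 * t + 2 * k + 2}"
      by (simp add: algebra_simps)
    finally show ?thesis by auto
  qed
qed

end

section \<open>The rows when the conductor is three modulo four\<close>

context
  fixes m x y z v :: int
  assumes m: "1 \<le> m"
begin

text \<open>The three generators lie within distance three of each other, so no two of them can sum to a third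
  and none divides another.\<close>

lemma first_row_3_mod_4:
  assumes "x = 4 * m + 3" "y = 4 * m + 5" "z = 4 * m + 6"
  shows "factorizations x y z x = {(1, 0, 0)}"
    and "factorizations x y z y = {(0, 1, 0)}"
    and "factorizations x y z z = {(0, 0, 1)}"
proof -
  show "factorizations x y z x = {(1, 0, 0)}"
    using m assms by (intro factorizations_first) auto
  have "\<not> x dvd y"
  proof
    assume "x dvd y"
    then have "x dvd y - x" by simp
    then show False using zdvd_imp_le[of x "y - x"] m assms by simp
  qed
  then show "factorizations x y z y = {(0, 1, 0)}"
    using m assms by (intro factorizations_second) auto
  have "p * x + q * y \<noteq> z" if "0 \<le> p" "0 \<le> q" for p q
  proof
    assume eq: "p * x + q * y = z"
    then have "p + q < 2"
      using coefficient_sum_less[of 0 p q 0 x x y z 2] that m assms by simp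
    then have "p = 0 \<and> q = 0 \<or> p = 1 \<and> q = 0 \<or> p = 0 \<and> q = 1" using that by linarith
    then show False using eq m assms by auto
  qed
  then show "factorizations x y z z = {(0, 0, 1)}"
    using m assms by (intro factorizations_third) auto
qed

text \<open>All targets of the remaining rows are below three times the smallest large generator \<open>4 m + 3\<close>, so a
  single size bound serves them all.\<close>

lemma factorizations_3_mod_4:
  assumes "x = 4" "4 * m + 3 \<le> y" "4 * m + 3 \<le> z" "v \<le> 8 * m + 8"
  shows "factorizations x y z v = {(p, q, r). 0 \<le> p \<and>
    (q = 0 \<and> r = 0 \<and> 4 * p = v \<or> q = 1 \<and> r = 0 \<and> 4 * p = v - y \<or> q = 0 \<and> r = 1 \<and> 4 * p = v - z \<or>
     q = 2 \<and> r = 0 \<and> 4 * p = v - 2 * y \<or> q = 1 \<and> r = 1 \<and> 4 * p = v - y - z \<or> q = 0 \<and> r = 2 \<and> 4 * p = v - 2 * z)}"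
  unfolding assms(1) using m assms by (intro factorizations_four_small[of "4 * m + 3"]) simp_all

lemma second_row_3_mod_4:
  assumes "x = 4" "y = 4 * m + 5" "z = 4 * m + 6"
  shows "v = 8 * m + 2 \<Longrightarrow> factorizations x y z v = {(m - 1, 0, 1)}"
    and "v = 8 * m + 4 \<Longrightarrow> factorizations x y z v = {(2 * m + 1, 0, 0)}"
    and "v = 8 * m + 5 \<Longrightarrow> factorizations x y z v = {(m, 1, 0)}"
proof -
  have ge: "4 * m + 3 \<le> y" "4 * m + 3 \<le> z" using assms by simp_all
  show "factorizations x y z v = {(m - 1, 0, 1)}" if v: "v = 8 * m + 2"
  proof -
    have "v \<le> 8 * m + 8" using v by simp
    note eq = factorizations_3_mod_4[OF assms(1) ge this]
    show ?thesis
      unfolding eq unfolding assms(2,3) v using m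
      by (intro equalityI subsetI, (elim CollectE case_prodE conjE disjE; simp; presburger), auto)
  qed
  show "factorizations x y z v = {(2 * m + 1, 0, 0)}" if v: "v = 8 * m + 4"
  proof -
    have "v \<le> 8 * m + 8" using v by simp
    note eq = factorizations_3_mod_4[OF assms(1) ge this]
    show ?thesis
      unfolding eq unfolding assms(2,3) v using m
      by (intro equalityI subsetI, (elim CollectE case_prodE conjE disjE; simp; presburger), auto)
  qed
  show "factorizations x y z v = {(m, 1, 0)}" if v: "v = 8 * m + 5"
  proof -
    have "v \<le> 8 * m + 8" using v by simp
    note eq = factorizations_3_mod_4[OF assms(1) ge this]
    show ?thesis
      unfolding eq unfolding assms(2,3) v using m
      by (intro equalityI subsetI, (elim CollectE case_prodE conjE disjE; simp; presburger), auto)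
  qed
qed

lemma third_row_3_mod_4:
  assumes "x = 4" "y = 4 * m + 3" "z = 4 * m + 6"
  shows "v = 8 * m + 4 \<Longrightarrow> factorizations x y z v = {(2 * m + 1, 0, 0)}"
    and "v = 8 * m + 6 \<Longrightarrow> factorizations x y z v = {(m, 0, 1), (0, 2, 0)}"
    and "v = 8 * m + 7 \<Longrightarrow> factorizations x y z v = {(m + 1, 1, 0)}"
proof -
  have ge: "4 * m + 3 \<le> y" "4 * m + 3 \<le> z" using assms by simp_all
  show "factorizations x y z v = {(2 * m + 1, 0, 0)}" if v: "v = 8 * m + 4"
  proof -
    have "v \<le> 8 * m + 8" using v by simp
    note eq = factorizations_3_mod_4[OF assms(1) ge this]
    show ?thesis
      unfolding eq unfolding assms(2,3) v using m
      by (intro equalityI subsetI, (elim CollectE case_prodE conjE disjE; simp; presburger), auto)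
  qed
  show "factorizations x y z v = {(m, 0, 1), (0, 2, 0)}" if v: "v = 8 * m + 6"
  proof -
    have "v \<le> 8 * m + 8" using v by simp
    note eq = factorizations_3_mod_4[OF assms(1) ge this]
    show ?thesis
      unfolding eq unfolding assms(2,3) v using m
      by (intro equalityI subsetI, (elim CollectE case_prodE conjE disjE; simp; presburger), auto)
  qed
  show "factorizations x y z v = {(m + 1, 1, 0)}" if v: "v = 8 * m + 7"
  proof -
    have "v \<le> 8 * m + 8" using v by simp
    note eq = factorizations_3_mod_4[OF assms(1) ge this]
    show ?thesis
      unfolding eq unfolding assms(2,3) v using m
      by (intro equalityI subsetI, (elim CollectE case_prodE conjE disjE; simp; presburger), auto)
  qed
qed

lemma fourth_row_3_mod_4:
  assumes "x = 4" "y = 4 * m + 3" "z = 4 * m + 5"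
  shows "v = 8 * m + 5 \<Longrightarrow> factorizations x y z v = {(m, 0, 1)}"
    and "v = 8 * m + 7 \<Longrightarrow> factorizations x y z v = {(m + 1, 1, 0)}"
    and "v = 8 * m + 8 \<Longrightarrow> factorizations x y z v = {(0, 1, 1), (2 * m + 2, 0, 0)}"
proof -
  have ge: "4 * m + 3 \<le> y" "4 * m + 3 \<le> z" using assms by simp_all
  show "factorizations x y z v = {(m, 0, 1)}" if v: "v = 8 * m + 5"
  proof -
    have "v \<le> 8 * m + 8" using v by simp
    note eq = factorizations_3_mod_4[OF assms(1) ge this]
    show ?thesis
      unfolding eq unfolding assms(2,3) v using m
      by (intro equalityI subsetI, (elim CollectE case_prodE conjE disjE; simp; presburger), auto)
  qed
  show "factorizations x y z v = {(m + 1, 1, 0)}" if v: "v = 8 * m + 7"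
  proof -
    have "v \<le> 8 * m + 8" using v by simp
    note eq = factorizations_3_mod_4[OF assms(1) ge this]
    show ?thesis
      unfolding eq unfolding assms(2,3) v using m
      by (intro equalityI subsetI, (elim CollectE case_prodE conjE disjE; simp; presburger), auto)
  qed
  show "factorizations x y z v = {(0, 1, 1), (2 * m + 2, 0, 0)}" if v: "v = 8 * m + 8"
  proof -
    have "v \<le> 8 * m + 8" using v by simp
    note eq = factorizations_3_mod_4[OF assms(1) ge this]
    show ?thesis
      unfolding eq unfolding assms(2,3) v using m
      by (intro equalityI subsetI, (elim CollectE case_prodE conjE disjE; simp; presburger), auto)
  qed
qed

end

section \<open>The classification\<close>

lemma real_le_quotient_iff:
  "real b \<le> real n / (2 * (2 * real k + 1)) \<longleftrightarrow> 2 * int b * (2 * int k + 1) \<le> int n"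
proof -
  have "real b \<le> real n / (2 * (2 * real k + 1)) \<longleftrightarrow> real b * (2 * (2 * real k + 1)) \<le> real n"
    by (intro pos_le_divide_eq) simp
  also have "\<dots> \<longleftrightarrow> real_of_int (2 * int b * (2 * int k + 1)) \<le> real_of_int (int n)"
    by (simp add: algebra_simps)
  finally show ?thesis by (simp only: of_int_le_iff)
qed

lemma row_factorization_matrices_by_rows:
  assumes min: "\<And>A. minimal_generating_set S A \<longleftrightarrow> A = {n1, n2, n3, n4}"
    and less: "n1 < n2" "n2 < n3" "n3 < n4" and "f \<in> PF S"
    and rows: "factorizations (int n2) (int n3) (int n4) (f + int n1) = F1"
      "factorizations (int n1) (int n3) (int n4) (f + int n2) = F2"
      "factorizations (int n1) (int n2) (int n4) (f + int n3) = F3"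
      "factorizations (int n1) (int n2) (int n3) (f + int n4) = F4"
  shows "{M. row_factorization_matrix S f M} =
    {mat_of_rows_list 4 [[-1, a12, a13, a14], [a21, -1, a23, a24], [a31, a32, -1, a34], [a41, a42, a43, -1]]
     | a12 a13 a14 a21 a23 a24 a31 a32 a34 a41 a42 a43.
       (a12, a13, a14) \<in> F1 \<and> (a21, a23, a24) \<in> F2 \<and> (a31, a32, a34) \<in> F3 \<and> (a41, a42, a43) \<in> F4}"
  using row_factorization_matrices_four_generators[OF min less \<open>f \<in> PF S\<close>] unfolding rows .

theorem proposition3p5:
  fixes S :: "nat set" and s :: nat
  assumes "numerical_semigroup S"
    and "arf S"
    and "semigroup_multiplicity S = 4"
    and "conductor S = s"
    and "s > 4"
  shows
    "(s mod 4 = 2 \<longrightarrow>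
       (\<exists>k \<in> {1..(s - 2) div 4}.
          S = generated {4, 4 * k + 2, s + 1, s + 3} \<and>
          PF S = {4 * int k - 2, int s - 3, int s - 1} \<and>
          {M. row_factorization_matrix S (4 * int k - 2) M} =
            {mat_of_rows_list 4
               [[-1, 1, 0, 0],
                [2 * int k, -1, 0, 0],
                [int k - 1, 0, -1, 1],
                [int k, 0, 1, -1]]} \<and>
          {M. row_factorization_matrix S (int s - 3) M} =
            {mat_of_rows_list 4
               [[-1, 0, 1, 0],
                [int k - 1, -1, 0, 1],
                [int s div 2 - int a - (2 * int a - 1) * int k, 2 * int a - 1, -1, 0],
                [int s div 2 - int b - 2 * int b * int k, 2 * int b, 0, -1]]
             | a b :: nat.
               1 \<le> a \<and> real a \<le> (real s + 2 * real k) / (2 * (2 * real k + 1)) \<and>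
               0 \<le> b \<and> real b \<le> real s / (2 * (2 * real k + 1))} \<and>
          {M. row_factorization_matrix S (int s - 1) M} =
            {mat_of_rows_list 4
               [[-1, 0, 0, 1],
                [int k, -1, 1, 0],
                [int s div 2 - int b - 2 * int b * int k, 2 * int b, -1, 0],
                [int s div 2 - int a + 1 - (2 * int a - 1) * int k, 2 * int a - 1, 0, -1]]
             | a b :: nat.
               1 \<le> a \<and> real a \<le> (real s + 2 * real k + 2) / (2 * (2 * real k + 1)) \<and>
               0 \<le> b \<and> real b \<le> real s / (2 * (2 * real k + 1))} \<union>
            {mat_of_rows_list 4
               [[-1, 0, 0, 1],
                [int k, -1, 1, 0],
                [int s div 2 - int b - 2 * int b * int k, 2 * int b, -1, 0],
                [0, 0, 2, -1]]
             | b :: nat.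
               0 \<le> b \<and> real b \<le> real s / (2 * (2 * real k + 1))})) \<and>
     (s mod 4 = 3 \<longrightarrow>
          S = generated {4, s, s + 2, s + 3} \<and>
          PF S = {int s - 4, int s - 2, int s - 1} \<and>
          {M. row_factorization_matrix S (int s - 4) M} =
            {mat_of_rows_list 4
               [[-1, 1, 0, 0],
                [(int s - 7) div 4, -1, 0, 1],
                [(int s - 1) div 2, 0, -1, 0],
                [(int s - 3) div 4, 0, 1, -1]]} \<and>
          {M. row_factorization_matrix S (int s - 2) M} =
            {mat_of_rows_list 4
               [[-1, 0, 1, 0],
                [(int s - 1) div 2, -1, 0, 0],
                [(int s - 3) div 4, 0, -1, 1],
                [(int s + 1) div 4, 1, 0, -1]],
             mat_of_rows_list 4
               [[-1, 0, 1, 0],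
                [(int s - 1) div 2, -1, 0, 0],
                [0, 2, -1, 0],
                [(int s + 1) div 4, 1, 0, -1]]} \<and>
          {M. row_factorization_matrix S (int s - 1) M} =
            {mat_of_rows_list 4
               [[-1, 0, 0, 1],
                [(int s - 3) div 4, -1, 1, 0],
                [(int s + 1) div 4, 1, -1, 0],
                [0, 1, 1, -1]],
             mat_of_rows_list 4
               [[-1, 0, 0, 1],
                [(int s - 3) div 4, -1, 1, 0],
                [(int s + 1) div 4, 1, -1, 0],
                [(int s + 1) div 2, 0, 0, -1]]})"
proof ((rule conjI; rule impI), goal_cases)
  case 1
  then have "s = 4 * (s div 4) + 2" by presburger
  then obtain m where s: "s = 4 * m + 2" by blast
  obtain k where k: "1 \<le> k" "k \<le> m" and kunz: "kunz_coordinates S (m + 1) k m"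
    using arf_multiplicity_four_kunz_2_mod_4[OF assms(1-3), of m] assms(4) s by auto
  interpret kunz_four S "m + 1" k m
    by unfold_locales (use k kunz in simp_all)
  have gens: "{4, 4 * (m + 1) + 1, 4 * k + 2, 4 * m + 3} = {4, 4 * k + 2, s + 1, s + 3}"
    unfolding s by auto
  have min: "minimal_generating_set S A \<longleftrightarrow> A = {4, 4 * k + 2, s + 1, s + 3}" for A
    using minimal_generating_set_iff[of A] unfolding gens .
  have PF: "PF S = {4 * int k - 2, int s - 3, int s - 1}"
    unfolding PF_eq s by auto
  have less: "4 < 4 * k + 2" "4 * k + 2 < s + 1" "s + 1 < s + 3" using k s by simp_all
  have K: "1 \<le> int k" "int k \<le> int m" using k by simp_all
  \<comment> \<open>The parametrized entries are written with \<open>s / 2\<close>, an integer because \<open>s\<close> is even.\<close>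
  have half: "int s div 2 = 2 * int m + 1" unfolding s by simp
  have n: "int 4 = 4" "int (4 * k + 2) = 4 * int k + 2" "int (s + 1) = 4 * int m + 3"
    "int (s + 3) = 4 * int m + 5" unfolding s by simp_all
  note rows = row_factorization_matrices_by_rows[OF min less]
  note first = first_row_2_mod_4[OF K n(2-4)]
  note second = second_row_2_mod_4[OF K n(1,3,4)]
  note third = third_row_2_mod_4[OF K n(1,2,4) half]
  note fourth = fourth_row_2_mod_4[OF K n(1,2,3) half]
  \<comment> \<open>The quotient bounds on the parameters say that the first entries of the rows are nonnegative.\<close>
  have bound_b: "real b \<le> real s / (2 * (2 * real k + 1)) \<longleftrightarrow>
      2 * int b * (2 * int k + 1) \<le> 2 * (int s div 2)" for b
    unfolding real_le_quotient_iff half using s by (simp add: add.commute)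
  have bound_a: "real a \<le> (real s + 2 * real k) / (2 * (2 * real k + 1)) \<longleftrightarrow>
      2 * int a * (2 * int k + 1) \<le> 2 * (int s div 2) + 2 * int k" for a
    using real_le_quotient_iff[of a "s + 2 * k" k] half s by (simp add: add_ac)
  have bound_a': "real a \<le> (real s + 2 * real k + 2) / (2 * (2 * real k + 1)) \<longleftrightarrow>
      2 * int a * (2 * int k + 1) \<le> 2 * (int s div 2) + 2 * int k + 2" for a
    using real_le_quotient_iff[of a "s + 2 * k + 2" k] half s by (simp add: add_ac)
  have i: "{M. row_factorization_matrix S (4 * int k - 2) M} =
          {mat_of_rows_list 4
             [[-1, 1, 0, 0],
              [2 * int k, -1, 0, 0],
              [int k - 1, 0, -1, 1],
              [int k, 0, 1, -1]]}"
  proof (subst rows)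
    show "4 * int k - 2 \<in> PF S" unfolding PF by simp
    have e: "4 * int k - 2 + int 4 = int (4 * k + 2)" by simp
    show "factorizations (int (4 * k + 2)) (int (s + 1)) (int (s + 3)) (4 * int k - 2 + int 4) = {(1, 0, 0)}"
      unfolding e by (rule first(1))
    show "factorizations (int 4) (int (s + 1)) (int (s + 3)) (4 * int k - 2 + int (4 * k + 2)) = {(2 * int k, 0, 0)}"
      by (rule second(1)) simp
    show "factorizations (int 4) (int (4 * k + 2)) (int (s + 3)) (4 * int k - 2 + int (s + 1)) = {(int k - 1, 0, 1)}"
      by (rule third(1)) (simp add: s)
    show "factorizations (int 4) (int (4 * k + 2)) (int (s + 1)) (4 * int k - 2 + int (s + 3)) = {(int k, 0, 1)}"
      by (rule fourth(1)) (simp add: s)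
  qed simp
  have ii: "{M. row_factorization_matrix S (int s - 3) M} =
          {mat_of_rows_list 4
             [[-1, 0, 1, 0],
              [int k - 1, -1, 0, 1],
              [int s div 2 - int a - (2 * int a - 1) * int k, 2 * int a - 1, -1, 0],
              [int s div 2 - int b - 2 * int b * int k, 2 * int b, 0, -1]]
           | a b :: nat.
             1 \<le> a \<and> real a \<le> (real s + 2 * real k) / (2 * (2 * real k + 1)) \<and>
             0 \<le> b \<and> real b \<le> real s / (2 * (2 * real k + 1))}"
  proof (subst rows)
    show "int s - 3 \<in> PF S" unfolding PF by simp
    have e: "int s - 3 + int 4 = int (s + 1)" by simp
    show "factorizations (int (4 * k + 2)) (int (s + 1)) (int (s + 3)) (int s - 3 + int 4) = {(0, 1, 0)}"
      unfolding e by (rule first(2))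
    show "factorizations (int 4) (int (s + 1)) (int (s + 3)) (int s - 3 + int (4 * k + 2)) = {(int k - 1, 0, 1)}"
      by (rule second(2)) (simp add: s)
    show "factorizations (int 4) (int (4 * k + 2)) (int (s + 3)) (int s - 3 + int (s + 1)) =
      {(int s div 2 - int a - (2 * int a - 1) * int k, 2 * int a - 1, 0) | a.
        1 \<le> a \<and> 2 * int a * (2 * int k + 1) \<le> 2 * (int s div 2) + 2 * int k}"
      by (rule third(2)) (simp add: s)
    show "factorizations (int 4) (int (4 * k + 2)) (int (s + 1)) (int s - 3 + int (s + 3)) =
      {(int s div 2 - int b - 2 * int b * int k, 2 * int b, 0) | b.
        2 * int b * (2 * int k + 1) \<le> 2 * (int s div 2)}"
      by (rule fourth(2)) (simp add: s)
  qed (unfold bound_a bound_b, simp, blast)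
  have iii: "{M. row_factorization_matrix S (int s - 1) M} =
          {mat_of_rows_list 4
             [[-1, 0, 0, 1],
              [int k, -1, 1, 0],
              [int s div 2 - int b - 2 * int b * int k, 2 * int b, -1, 0],
              [int s div 2 - int a + 1 - (2 * int a - 1) * int k, 2 * int a - 1, 0, -1]]
           | a b :: nat.
             1 \<le> a \<and> real a \<le> (real s + 2 * real k + 2) / (2 * (2 * real k + 1)) \<and>
             0 \<le> b \<and> real b \<le> real s / (2 * (2 * real k + 1))} \<union>
          {mat_of_rows_list 4
             [[-1, 0, 0, 1],
              [int k, -1, 1, 0],
              [int s div 2 - int b - 2 * int b * int k, 2 * int b, -1, 0],
              [0, 0, 2, -1]]
           | b :: nat.
             0 \<le> b \<and> real b \<le> real s / (2 * (2 * real k + 1))}"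
  proof (subst rows)
    show "int s - 1 \<in> PF S" unfolding PF by simp
    have e: "int s - 1 + int 4 = int (s + 3)" by simp
    show "factorizations (int (4 * k + 2)) (int (s + 1)) (int (s + 3)) (int s - 1 + int 4) = {(0, 0, 1)}"
      unfolding e by (rule first(3))
    show "factorizations (int 4) (int (s + 1)) (int (s + 3)) (int s - 1 + int (4 * k + 2)) = {(int k, 1, 0)}"
      by (rule second(3)) (simp add: s)
    show "factorizations (int 4) (int (4 * k + 2)) (int (s + 3)) (int s - 1 + int (s + 1)) =
      {(int s div 2 - int b - 2 * int b * int k, 2 * int b, 0) | b.
        2 * int b * (2 * int k + 1) \<le> 2 * (int s div 2)}"
      by (rule third(3)) (simp add: s)
    show "factorizations (int 4) (int (4 * k + 2)) (int (s + 1)) (int s - 1 + int (s + 3)) =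
      {(int s div 2 - int a + 1 - (2 * int a - 1) * int k, 2 * int a - 1, 0) | a.
        1 \<le> a \<and> 2 * int a * (2 * int k + 1) \<le> 2 * (int s div 2) + 2 * int k + 2} \<union> {(0, 0, 2)}"
      by (rule fourth(3)) (simp add: s)
  qed (unfold bound_a' bound_b, simp, blast)
  have "k \<in> {1..(s - 2) div 4}" using k s by simp
  moreover have "S = generated {4, 4 * k + 2, s + 1, s + 3}"
    using generated_eq unfolding gens .
  ultimately show ?case
    using PF i ii iii by (intro bexI[of _ k] conjI)
next
  case 2
  then have "s = 4 * (s div 4) + 3" by presburger
  then obtain m where s: "s = 4 * m + 3" by blast
  with \<open>s > 4\<close> have m: "1 \<le> m" by simp
  have kunz: "kunz_coordinates S (m + 1) (m + 1) m"
    using arf_multiplicity_four_kunz_3_mod_4[OF assms(1-3), of m] assms(4) s by simp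
  interpret kunz_four S "m + 1" "m + 1" m
    by unfold_locales (use m kunz in simp_all)
  have gens: "{4, 4 * (m + 1) + 1, 4 * (m + 1) + 2, 4 * m + 3} = {4, s, s + 2, s + 3}"
    unfolding s by auto
  have min: "minimal_generating_set S A \<longleftrightarrow> A = {4, s, s + 2, s + 3}" for A
    using minimal_generating_set_iff[of A] unfolding gens .
  have gen: "S = generated {4, s, s + 2, s + 3}"
    using generated_eq unfolding gens .
  have PF: "PF S = {int s - 4, int s - 2, int s - 1}"
    unfolding PF_eq s by auto
  have less: "4 < s" "s < s + 2" "s + 2 < s + 3" using \<open>s > 4\<close> by simp_all
  have M: "1 \<le> int m" using m by simp
  have n: "int 4 = 4" "int s = 4 * int m + 3" "int (s + 2) = 4 * int m + 5"
    "int (s + 3) = 4 * int m + 6" unfolding s by simp_all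
  have quotients: "(int s - 7) div 4 = int m - 1" "(int s - 1) div 2 = 2 * int m + 1"
    "(int s - 3) div 4 = int m" "(int s + 1) div 4 = int m + 1" "(int s + 1) div 2 = 2 * int m + 2"
    unfolding n(2) by simp_all
  note rows = row_factorization_matrices_by_rows[OF min less]
  note first = first_row_3_mod_4[OF M n(2-4)]
  note second = second_row_3_mod_4[OF M n(1,3,4)]
  note third = third_row_3_mod_4[OF M n(1,2,4)]
  note fourth = fourth_row_3_mod_4[OF M n(1,2,3)]
  have i: "{M. row_factorization_matrix S (int s - 4) M} =
            {mat_of_rows_list 4
               [[-1, 1, 0, 0],
                [(int s - 7) div 4, -1, 0, 1],
                [(int s - 1) div 2, 0, -1, 0],
                [(int s - 3) div 4, 0, 1, -1]]}"
    unfolding quotients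
  proof (subst rows)
    show "int s - 4 \<in> PF S" unfolding PF by simp
    have e: "int s - 4 + int 4 = int s" by simp
    show "factorizations (int s) (int (s + 2)) (int (s + 3)) (int s - 4 + int 4) = {(1, 0, 0)}"
      unfolding e by (rule first(1))
    show "factorizations (int 4) (int (s + 2)) (int (s + 3)) (int s - 4 + int s) = {(int m - 1, 0, 1)}"
      by (rule second(1)) (simp add: s)
    show "factorizations (int 4) (int s) (int (s + 3)) (int s - 4 + int (s + 2)) = {(2 * int m + 1, 0, 0)}"
      by (rule third(1)) (simp add: s)
    show "factorizations (int 4) (int s) (int (s + 2)) (int s - 4 + int (s + 3)) = {(int m, 0, 1)}"
      by (rule fourth(1)) (simp add: s)
  qed simp
  have ii: "{M. row_factorization_matrix S (int s - 2) M} =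
            {mat_of_rows_list 4
               [[-1, 0, 1, 0],
                [(int s - 1) div 2, -1, 0, 0],
                [(int s - 3) div 4, 0, -1, 1],
                [(int s + 1) div 4, 1, 0, -1]],
             mat_of_rows_list 4
               [[-1, 0, 1, 0],
                [(int s - 1) div 2, -1, 0, 0],
                [0, 2, -1, 0],
                [(int s + 1) div 4, 1, 0, -1]]}"
    unfolding quotients
  proof (subst rows)
    show "int s - 2 \<in> PF S" unfolding PF by simp
    have e: "int s - 2 + int 4 = int (s + 2)" by simp
    show "factorizations (int s) (int (s + 2)) (int (s + 3)) (int s - 2 + int 4) = {(0, 1, 0)}"
      unfolding e by (rule first(2))
    show "factorizations (int 4) (int (s + 2)) (int (s + 3)) (int s - 2 + int s) = {(2 * int m + 1, 0, 0)}"
      by (rule second(2)) (simp add: s)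
    show "factorizations (int 4) (int s) (int (s + 3)) (int s - 2 + int (s + 2)) = {(int m, 0, 1), (0, 2, 0)}"
      by (rule third(2)) (simp add: s)
    show "factorizations (int 4) (int s) (int (s + 2)) (int s - 2 + int (s + 3)) = {(int m + 1, 1, 0)}"
      by (rule fourth(2)) (simp add: s)
  qed (simp, blast)
  have iii: "{M. row_factorization_matrix S (int s - 1) M} =
            {mat_of_rows_list 4
               [[-1, 0, 0, 1],
                [(int s - 3) div 4, -1, 1, 0],
                [(int s + 1) div 4, 1, -1, 0],
                [0, 1, 1, -1]],
             mat_of_rows_list 4
               [[-1, 0, 0, 1],
                [(int s - 3) div 4, -1, 1, 0],
                [(int s + 1) div 4, 1, -1, 0],
                [(int s + 1) div 2, 0, 0, -1]]}"
    unfolding quotients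
  proof (subst rows)
    show "int s - 1 \<in> PF S" unfolding PF by simp
    have e: "int s - 1 + int 4 = int (s + 3)" by simp
    show "factorizations (int s) (int (s + 2)) (int (s + 3)) (int s - 1 + int 4) = {(0, 0, 1)}"
      unfolding e by (rule first(3))
    show "factorizations (int 4) (int (s + 2)) (int (s + 3)) (int s - 1 + int s) = {(int m, 1, 0)}"
      by (rule second(3)) (simp add: s)
    show "factorizations (int 4) (int s) (int (s + 3)) (int s - 1 + int (s + 2)) = {(int m + 1, 1, 0)}"
      by (rule third(3)) (simp add: s)
    show "factorizations (int 4) (int s) (int (s + 2)) (int s - 1 + int (s + 3)) = {(0, 1, 1), (2 * int m + 2, 0, 0)}"
      by (rule fourth(3)) (simp add: s)
  qed (simp, blast)
  show ?case
    by (intro conjI gen PF i ii iii)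
qed

end
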